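(* Let $G=(V,E,w)$ be an $n$-vertex weighted graph and $\epsilon\in(0,1]$. There is a distribution $\mathcal{D}$ over spanning clan embeddings $(f,\chi)$ of $G$ into trees with multiplicative distortion $O(\frac{\log n\log\log n}{\epsilon})$ such that for every vertex $v\in V$, $\mathbb{E}_{(f,\chi)\sim\mathcal{D}}[|f(v)|]\le 1+\epsilon$. In addition, for every $k\in\mathbb{N}$, there is a distribution $\mathcal{D}$ over spanning clan embeddings $(f,\chi)$ of $G$ into trees with multiplicative distortion $O(k\log\log n)$ such that for every vertex $v\in V$, $\mathbb{E}_{(f,\chi)\sim\mathcal{D}}[|f(v)|]=O(n^{\frac1k})$.
   Context: Graphs are considered with their shortest-path metrics $d_G$. A one-to-many embedding $f:V\to 2^{V(H)}$ from $G$ into a weighted graph $H$ maps each vertex to a non-empty set of vertices of $H$, the sets pairwise disjoint; it is dominating if $d_G(u,v)\le\min_{u'\in f(u),v'\in f(v)}d_H(u',v')$. A clan embedding is a pair $(f,\chi)$ with $f$ a dominating one-to-many embedding and $\chi(v)\in f(v)$ for every $v$; it has multiplicative distortion $t$ if $\min_{u'\in f(u)}d_H(u',\chi(v))\le t\cdot d_G(u,v)$ for all $u,v$. The clan embedding is spanning if $V(H)=\bigcup_v f(v)$ and for every edge $\{u',v'\}\in E(H)$ with $u'\in f(u)$, $v'\in f(v)$ we have $\{u,v\}\in E$ and $w_H(u',v')=w(u,v)$. *)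

theory Defs
  imports "HOL-Probability.Probability" "Graph_Theory.Graph_Theory"
begin

(* A finite undirected simple graph is a pair_graph: every edge {u,v} is present as both
   arcs (u,v) and (v,u), so an edge weight is a function on arcs that agrees on the two. *)
definition weighted_graph :: "'a pair_pre_digraph \<Rightarrow> ('a \<times> 'a \<Rightarrow> real) \<Rightarrow> bool" where
  "weighted_graph G w \<longleftrightarrow>
     pair_graph G \<and> Digraph_Component.connected (with_proj G) \<and>
     (\<forall>(u, v) \<in> parcs G. w (u, v) = w (v, u) \<and> 0 \<le> w (u, v))"

abbreviation sp_dist :: "'a pair_pre_digraph \<Rightarrow> ('a \<times> 'a \<Rightarrow> real) \<Rightarrow> 'a \<Rightarrow> 'a \<Rightarrow> ereal" where
  "sp_dist G w \<equiv> wf_digraph.\<mu> (with_proj G) w"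

(* Digraph_Component.tree is not usable here: it forbids every directed cycle, and in a
   symmetric digraph each edge, traversed back and forth, is one. Cycles of the undirected
   graph are the directed cycles of length at least 3. *)
definition undirected_tree :: "'a pair_pre_digraph \<Rightarrow> bool" where
  "undirected_tree T \<longleftrightarrow>
     pair_graph T \<and> Digraph_Component.connected (with_proj T) \<and>
     \<not> (\<exists>p. pre_digraph.cycle (with_proj T) p \<and> 3 \<le> length p)"

definition one_to_many_embedding ::
  "'a pair_pre_digraph \<Rightarrow> 'b pair_pre_digraph \<Rightarrow> ('a \<Rightarrow> 'b set) \<Rightarrow> bool" where
  "one_to_many_embedding G H f \<longleftrightarrow>
     (\<forall>v \<in> pverts G. f v \<noteq> {} \<and> f v \<subseteq> pverts H) \<and> disjoint_family_on f (pverts G)"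

(* Below, infima range over sets that are finite and non-empty when f is a one-to-many
   embedding into a finite graph, so they are minima. *)
definition dominating ::
  "'a pair_pre_digraph \<Rightarrow> ('a \<times> 'a \<Rightarrow> real) \<Rightarrow> 'b pair_pre_digraph \<Rightarrow> ('b \<times> 'b \<Rightarrow> real) \<Rightarrow>
   ('a \<Rightarrow> 'b set) \<Rightarrow> bool" where
  "dominating G w H wH f \<longleftrightarrow>
     (\<forall>u \<in> pverts G. \<forall>v \<in> pverts G.
        sp_dist G w u v \<le> (INF (u', v') \<in> f u \<times> f v. sp_dist H wH u' v'))"

definition clan_embedding ::
  "'a pair_pre_digraph \<Rightarrow> ('a \<times> 'a \<Rightarrow> real) \<Rightarrow> 'b pair_pre_digraph \<Rightarrow> ('b \<times> 'b \<Rightarrow> real) \<Rightarrow>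
   ('a \<Rightarrow> 'b set) \<Rightarrow> ('a \<Rightarrow> 'b) \<Rightarrow> bool" where
  "clan_embedding G w H wH f chi \<longleftrightarrow>
     one_to_many_embedding G H f \<and> dominating G w H wH f \<and> (\<forall>v \<in> pverts G. chi v \<in> f v)"

definition multiplicative_distortion ::
  "'a pair_pre_digraph \<Rightarrow> ('a \<times> 'a \<Rightarrow> real) \<Rightarrow> 'b pair_pre_digraph \<Rightarrow> ('b \<times> 'b \<Rightarrow> real) \<Rightarrow>
   ('a \<Rightarrow> 'b set) \<Rightarrow> ('a \<Rightarrow> 'b) \<Rightarrow> real \<Rightarrow> bool" where
  "multiplicative_distortion G w H wH f chi t \<longleftrightarrow>
     (\<forall>u \<in> pverts G. \<forall>v \<in> pverts G.
        (INF u' \<in> f u. sp_dist H wH u' (chi v)) \<le> ereal t * sp_dist G w u v)"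

definition spanning_embedding ::
  "'a pair_pre_digraph \<Rightarrow> ('a \<times> 'a \<Rightarrow> real) \<Rightarrow> 'b pair_pre_digraph \<Rightarrow> ('b \<times> 'b \<Rightarrow> real) \<Rightarrow>
   ('a \<Rightarrow> 'b set) \<Rightarrow> bool" where
  "spanning_embedding G w H wH f \<longleftrightarrow>
     pverts H = (\<Union>v \<in> pverts G. f v) \<and>
     (\<forall>u \<in> pverts G. \<forall>v \<in> pverts G. \<forall>u' \<in> f u. \<forall>v' \<in> f v.
        (u', v') \<in> parcs H \<longrightarrow> (u, v) \<in> parcs G \<and> wH (u', v') = w (u, v))"

(* Host graph, its weights, f, and chi. *)
type_synonym ('a, 'b) embedding =
  "'b pair_pre_digraph \<times> ('b \<times> 'b \<Rightarrow> real) \<times> ('a \<Rightarrow> 'b set) \<times> ('a \<Rightarrow> 'b)"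

definition spanning_tree_clan_embeddings ::
  "'a pair_pre_digraph \<Rightarrow> ('a \<times> 'a \<Rightarrow> real) \<Rightarrow> real \<Rightarrow> ('a, 'b) embedding set" where
  "spanning_tree_clan_embeddings G w t =
     {(H, wH, f, chi). weighted_graph H wH \<and> undirected_tree H \<and>
        clan_embedding G w H wH f chi \<and> spanning_embedding G w H wH f \<and>
        multiplicative_distortion G w H wH f chi t}"

definition copies :: "'a \<Rightarrow> ('a, 'b) embedding \<Rightarrow> real" where
  "copies v = (\<lambda>(H, wH, f, chi). real (card (f v)))"

(* The maximum only matters for n < 4, where log log n would be below 1, zero,
   negative or undefined; it lets the asymptotic bounds be stated for every n. *)
definition loglog :: "nat \<Rightarrow> real" where
  "loglog n = max 1 (log 2 (log 2 (real n)))"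

end

theory Submission
  imports Defs
begin

text \<open>
  For a fixed measure on the vertices, a single tree is built by recursive cuts along petals, as in
  the petal decomposition of Abraham and Neiman. A cut of a cluster takes two nested petals around
  the end of a shortest path from the root and recurses on the larger petal and on the complement
  of the smaller one; the vertices in between are duplicated, and each vertex chooses as its chief
  the copy on the side that contains its neighbourhood. Among about \<open>k log log n\<close> nested petals there
  are two consecutive ones whose difference is so light that the bound \<open>\<mu>(X)\<close> to the power
  \<open>1 + 1/k\<close> on the total measure of the copies is inherited from the two sides. Halving the path into
  the petal compensates the detour caused by the cut, and since no edge is halved twice, the depth
  of the trees stays proportional to the radius at all levels. A minimax argument over the measures
  turns the trees into a distribution.
\<close>

section \<open>Walks and distances from a root\<close>

text \<open>Tree edges must be graph edges, which rules out balls as clusters: hooking a ball up by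
  an edge can stretch root distances by a constant factor, and such factors multiply over the
  recursion. Superlevel sets of the gain from halving avoid this. Their complements keep root
  distances, and inside them halved distances are the old ones shifted, so each cut reproduces the
  invariant \<open>dep \<le> 2 * d\<close> without loss. Tree distances in a cluster are then
  proportional to its radius, and only walks longer than a fraction \<open>1 / L\<close> of the
  radius, up to constants, can be separated from the chief. The quotient is the distortion, with
  \<open>L\<close> of order \<open>loglog n / \<kappa>\<close>. One exponent serves both claims:
  \<open>M powr (1 + \<kappa>)\<close> exceeds \<open>M\<close> by the factor
  \<open>M powr \<kappa>\<close>, which is of order \<open>n powr (1 / k)\<close> for
  \<open>\<kappa> = 1 / k\<close> and close to 1 for \<open>\<kappa>\<close> proportional to
  \<open>\<epsilon> / log n\<close>. A single tree bounds only the weighted number of copies. As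
  there are infinitely many trees, the game is resolved by repeated play up to a slack, for which
  the constants leave room.\<close>

inductive walk_cost :: "'v rel \<Rightarrow> ('v \<times> 'v \<Rightarrow> real) \<Rightarrow> 'v \<Rightarrow> 'v \<Rightarrow> real \<Rightarrow> bool"
  for E w u where
  walk_refl: "walk_cost E w u u 0"
| walk_step: "walk_cost E w u y c \<Longrightarrow> (y, z) \<in> E \<Longrightarrow> walk_cost E w u z (c + w (y, z))"

lemma walk_trans:
  "walk_cost E w v z c' \<Longrightarrow> walk_cost E w u v c \<Longrightarrow> walk_cost E w u z (c + c')"
proof (induction rule: walk_cost.induct)
  case (walk_step y c' z)
  then show ?case using walk_cost.walk_step[of E w u y "c + c'" z] by (simp add: add.assoc)
qed simp

lemma walk_edge: "(u, v) \<in> E \<Longrightarrow> walk_cost E w u v (w (u, v))"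
  using walk_step[OF walk_refl] by fastforce

lemma walk_mono:
  assumes "walk_cost E w u v c" "E \<subseteq> E'" "\<And>e. e \<in> E \<Longrightarrow> w' e = w e"
  shows "walk_cost E' w' u v c"
  using assms(1)
proof (induction rule: walk_cost.induct)
  case (walk_step y c z)
  then show ?case using walk_cost.walk_step[of E' w' u y c z] assms by auto
qed (rule walk_refl)

lemma walk_map:
  assumes "walk_cost E w u v c"
    "\<And>y z. (y, z) \<in> E \<Longrightarrow> (h y, h z) \<in> E' \<and> w' (h y, h z) = w (y, z)"
  shows "walk_cost E' w' (h u) (h v) c"
  using assms(1)
proof (induction rule: walk_cost.induct)
  case (walk_step y c z)
  then show ?case using walk_cost.walk_step[of E' w' "h u" "h y" c "h z"] assms(2)[of y z] by auto
qed (rule walk_refl)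

lemma walk_cheaper:
  assumes "walk_cost E w u v c" "\<And>e. e \<in> E \<Longrightarrow> w' e \<le> w e"
  obtains c' where "c' \<le> c" "walk_cost E w' u v c'"
proof -
  from assms(1) have "\<exists>c' \<le> c. walk_cost E w' u v c'"
  proof (induction rule: walk_cost.induct)
    case (walk_step y c z)
    then obtain c' where "c' \<le> c" "walk_cost E w' u y c'" by auto
    with walk_step assms(2) show ?case
      by (intro exI[of _ "c' + w' (y, z)"]) (auto intro: walk_cost.walk_step add_mono)
  qed (auto intro: walk_refl)
  then show thesis using that by auto
qed

lemma walk_nonneg:
  assumes "walk_cost E w u v c" "\<And>e. e \<in> E \<Longrightarrow> 0 \<le> w e"
  shows "0 \<le> c"
  using assms(1) by induction (use assms(2) in \<open>auto intro: add_nonneg_nonneg\<close>)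

lemma walk_rev:
  assumes "walk_cost E w u v c" "sym E" "\<And>x y. (x, y) \<in> E \<Longrightarrow> w (x, y) = w (y, x)"
  shows "walk_cost E w v u c"
  using assms(1)
proof (induction rule: walk_cost.induct)
  case (walk_step y c z)
  then have "(z, y) \<in> E" using assms(2) by (auto dest: symD)
  from walk_trans[OF walk_step(3) walk_edge[OF this]] show ?case
    using walk_step assms(3)[of y z] by (simp add: add.commute)
qed (rule walk_refl)

lemma walk_in: "walk_cost (Restr E X) w u v c \<Longrightarrow> u \<in> X \<Longrightarrow> v \<in> X"
  by (induction rule: walk_cost.induct) auto

lemma walk_in_rev: "walk_cost (Restr E X) w u v c \<Longrightarrow> v \<in> X \<Longrightarrow> u \<in> X"
  by (induction rule: walk_cost.induct) auto

lemma walk_lipschitz: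
  assumes "walk_cost E w u v c" "\<And>y z. (y, z) \<in> E \<Longrightarrow> d z \<le> d y + w (y, z)"
  shows "d v \<le> d u + (c :: real)"
  using assms(1)
proof (induction rule: walk_cost.induct)
  case (walk_step y c z)
  then show ?case using assms(2)[of y z] by auto
qed simp

text \<open>The rest of the walk from any of its vertices to \<open>v\<close> costs at most
  \<open>c\<close>, so \<open>g\<close> stays within \<open>2 * c\<close> of its value at
  \<open>v\<close>. The comparison is with the end of the walk because the chief of \<open>v\<close>
  will be chosen by \<open>g v\<close>.\<close>

lemma walk_near:
  assumes "walk_cost (Restr E X) w u v c" "\<And>e. e \<in> Restr E X \<Longrightarrow> 0 \<le> w e"
    "\<And>y z. (y, z) \<in> Restr E X \<Longrightarrow> \<bar>g y - g z\<bar> \<le> 2 * w (y, z)"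
    "\<And>z. z \<in> X \<Longrightarrow> \<bar>g z - g v\<bar> \<le> 2 * (c :: real) \<Longrightarrow> z \<in> S"
  shows "walk_cost (Restr E S) w u v c"
  using assms(1,4)
proof (induction rule: walk_cost.induct)
  case (walk_step y c z)
  have c: "0 \<le> c" using walk_nonneg[OF walk_step(1) assms(2)] .
  have e: "y \<in> X" "z \<in> X" "(y, z) \<in> E" using walk_step by auto
  have L: "\<bar>g y - g z\<bar> \<le> 2 * w (y, z)" using assms(3) walk_step(2) .
  have "walk_cost (Restr E S) w u y c"
  proof (rule walk_step.IH)
    fix x assume "x \<in> X" "\<bar>g x - g y\<bar> \<le> 2 * c"
    then show "x \<in> S" using L by (intro walk_step.prems) auto
  qed
  moreover have "y \<in> S" using e L c by (intro walk_step.prems) auto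
  moreover have "z \<in> S" using e L c by (intro walk_step.prems) auto
  ultimately show ?case using e by (intro walk_cost.walk_step) auto
qed (rule walk_refl)

text \<open>With nonnegative weights, whatever follows an edge leaving \<open>S\<close> can only add
  cost. This lower bound makes the cheapest boundary edge optimal in Dijkstra's algorithm.\<close>

lemma walk_leaves:
  assumes "walk_cost E w u v c" "u \<in> S" "\<And>e. e \<in> E \<Longrightarrow> 0 \<le> w e"
  shows "v \<in> S \<or> (\<exists>y z c'. y \<in> S \<and> z \<notin> S \<and> (y, z) \<in> E \<and> walk_cost E w u y c' \<and> c' + w (y, z) \<le> c)"
  using assms(1)
proof (induction rule: walk_cost.induct)
  case (walk_step y c z)
  then show ?case using assms(3)[of "(y, z)"] by (smt (verit, best))
qed (use assms in simp)

text \<open>Dijkstra's algorithm: the settled set grows by the cheapest outgoing edge.\<close>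
lemma min_walk_exists:
  assumes "finite X" "x \<in> X" "\<And>z. z \<in> X \<Longrightarrow> \<exists>c. walk_cost (Restr E X) w x z c"
    "\<And>e. e \<in> Restr E X \<Longrightarrow> 0 \<le> w e"
  shows "\<exists>d. \<forall>z\<in>X. walk_cost (Restr E X) w x z (d z) \<and> (\<forall>c. walk_cost (Restr E X) w x z c \<longrightarrow> d z \<le> c)"
proof -
  let ?W = "walk_cost (Restr E X) w x"
  define opt where "opt z a \<longleftrightarrow> ?W z a \<and> (\<forall>c. ?W z c \<longrightarrow> a \<le> c)" for z a
  have "\<exists>S d. S \<subseteq> X \<and> x \<in> S \<and> card S = Suc n \<and> (\<forall>z\<in>S. opt z (d z))" if "n < card X" for n
    using that
  proof (induction n)
    case 0
    have "0 \<le> c" if "?W x c" for c using walk_nonneg[OF that assms(4)] .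
    then have "opt x 0" unfolding opt_def by (blast intro: walk_refl)
    then show ?case using assms(2) by (intro exI[of _ "{x}"] exI[of _ "\<lambda>_. 0"]) auto
  next
    case (Suc n)
    then obtain S d where S: "S \<subseteq> X" "x \<in> S" "card S = Suc n" "\<And>z. z \<in> S \<Longrightarrow> opt z (d z)" by auto
    define B where "B = {(y, z). (y, z) \<in> Restr E X \<and> y \<in> S \<and> z \<notin> S}"
    have "finite B" unfolding B_def by (rule finite_subset[of _ "X \<times> X"]) (use assms(1) in auto)
    obtain t where "t \<in> X - S" using S Suc.prems assms(1)
      by (metis Diff_eq_empty_iff all_not_in_conv card_mono not_le rev_finite_subset)
    then obtain c where "?W t c" using assms(3) by auto
    from walk_leaves[OF this \<open>x \<in> S\<close> assms(4)] \<open>t \<in> X - S\<close> have "B \<noteq> {}" by (auto simp: B_def)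
    define e where "e = arg_min_on (\<lambda>e. d (fst e) + w e) B"
    have e: "e \<in> B" "\<And>e'. e' \<in> B \<Longrightarrow> d (fst e) + w e \<le> d (fst e') + w e'"
      using arg_min_if_finite[OF \<open>finite B\<close> \<open>B \<noteq> {}\<close>, of "\<lambda>e. d (fst e) + w e"]
      unfolding e_def by (auto simp: not_less)
    obtain y z where yz: "e = (y, z)" by force
    have *: "y \<in> S" "z \<notin> S" "z \<in> X" "(y, z) \<in> Restr E X" using e(1) by (auto simp: B_def yz)
    have "opt z (d y + w (y, z))"
      unfolding opt_def
    proof (intro conjI allI impI)
      show "?W z (d y + w (y, z))" using S(4)[OF *(1)] *(4) by (auto simp: opt_def intro: walk_step)
      fix c assume "?W z c"
      from walk_leaves[OF this \<open>x \<in> S\<close> assms(4)] \<open>z \<notin> S\<close> obtain y' z' c' where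
        y': "y' \<in> S" "z' \<notin> S" "(y', z') \<in> Restr E X" "?W y' c'" "c' + w (y', z') \<le> c" by auto
      then have "d y' \<le> c'" using S(4)[of y'] by (auto simp: opt_def)
      then show "d y + w (y, z) \<le> c" using e(2)[of "(y', z')"] y' by (auto simp: B_def yz)
    qed
    then show ?case using S * finite_subset[OF S(1) assms(1)]
      by (intro exI[of _ "insert z S"] exI[of _ "d(z := d y + w (y, z))"]) auto
  qed
  from this[of "card X - 1"] obtain S d where S: "S \<subseteq> X" "card S = card X" "\<forall>z\<in>S. opt z (d z)"
    using assms(1,2) by (metis Suc_diff_1 card_gt_0_iff diff_less emptyE zero_less_one)
  then have "S = X" using assms(1) by (metis card_subset_eq)
  then show ?thesis using S(3) by (auto simp: opt_def)
qed

text \<open>A certificate in place of a minimum: walks attain \<open>d\<close>, and \<open>d\<close>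
  is a feasible potential, so no walk is cheaper (\<open>root_dist_walk_from_root\<close>). Outside
  \<open>X\<close> the function is unconstrained, so the same \<open>d\<close> can serve a
  subcluster.\<close>

definition root_dist :: "'v rel \<Rightarrow> 'v set \<Rightarrow> ('v \<times> 'v \<Rightarrow> real) \<Rightarrow> 'v \<Rightarrow> ('v \<Rightarrow> real) \<Rightarrow> bool" where
  "root_dist E X w x d \<longleftrightarrow> finite X \<and> x \<in> X \<and> d x = 0 \<and>
     (\<forall>z\<in>X. walk_cost (Restr E X) w x z (d z)) \<and>
     (\<forall>(y, z)\<in>Restr E X. d z \<le> d y + w (y, z) \<and> 0 \<le> w (y, z))"

lemma root_distD:
  assumes "root_dist E X w x d"
  shows "finite X" "x \<in> X" "d x = 0" "z \<in> X \<Longrightarrow> walk_cost (Restr E X) w x z (d z)"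
    "(y, z) \<in> Restr E X \<Longrightarrow> d z \<le> d y + w (y, z)" "e \<in> Restr E X \<Longrightarrow> 0 \<le> w e"
  using assms by (auto simp: root_dist_def)

lemma root_dist_nonneg:
  assumes "root_dist E X w x d" "z \<in> X"
  shows "0 \<le> d z"
  using walk_nonneg[OF root_distD(4)[OF assms] root_distD(6)[OF assms(1)]] .

lemma root_dist_walk_le:
  assumes "root_dist E X w x d" "walk_cost (Restr E X) w y z c"
  shows "d z \<le> d y + c"
  using walk_lipschitz[OF assms(2) root_distD(5)[OF assms(1)]] by simp

lemma root_dist_walk_from_root:
  assumes "root_dist E X w x d" "walk_cost (Restr E X) w x z c"
  shows "d z \<le> c"
  using root_dist_walk_le[OF assms] root_distD(3)[OF assms(1)] by simp

lemma root_dist_exists: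
  assumes "finite X" "x \<in> X" "\<And>z. z \<in> X \<Longrightarrow> \<exists>c. walk_cost (Restr E X) w x z c"
    "\<And>e. e \<in> Restr E X \<Longrightarrow> 0 \<le> w e"
  obtains d where "root_dist E X w x d"
proof -
  obtain d where d: "\<And>z. z \<in> X \<Longrightarrow> walk_cost (Restr E X) w x z (d z)"
    "\<And>z c. z \<in> X \<Longrightarrow> walk_cost (Restr E X) w x z c \<Longrightarrow> d z \<le> c"
    using min_walk_exists[OF assms] by auto
  have "d x = 0"
    using d(2)[OF assms(2) walk_refl] walk_nonneg[OF d(1)[OF assms(2)] assms(4)] by auto
  moreover have "d z \<le> d y + w (y, z)" if "(y, z) \<in> Restr E X" for y z
    using that by (intro d(2) walk_step d(1)) auto
  ultimately have "root_dist E X w x d" using assms d(1) by (auto simp: root_dist_def)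
  then show thesis by (rule that)
qed

lemma root_dist_cheaper:
  assumes "root_dist E X w x d" "\<And>e. e \<in> Restr E X \<Longrightarrow> 0 \<le> w' e \<and> w' e \<le> w e"
  obtains d' where "root_dist E X w' x d'"
proof (rule root_dist_exists[OF root_distD(1,2)[OF assms(1)]])
  show "\<exists>c. walk_cost (Restr E X) w' x z c" if "z \<in> X" for z
    using walk_cheaper[OF root_distD(4)[OF assms(1) that], of w'] assms(2) by metis
  show "0 \<le> w' e" if "e \<in> Restr E X" for e using assms(2)[OF that] by simp
qed (rule that)

text \<open>A shortest path from the root is the vertex sequence \<open>p 0, \<dots>, p m\<close>; consecutive vertices may
  be at distance zero, and the sequence is only constrained up to \<open>m\<close>.\<close>
definition tight_path ::
  "'v rel \<Rightarrow> 'v set \<Rightarrow> ('v \<times> 'v \<Rightarrow> real) \<Rightarrow> 'v \<Rightarrow> ('v \<Rightarrow> real) \<Rightarrow> (nat \<Rightarrow> 'v) \<Rightarrow> nat \<Rightarrow> bool" where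
  "tight_path E X w x d p m \<longleftrightarrow> p 0 = x \<and>
     (\<forall>i<m. (p i, p (Suc i)) \<in> Restr E X \<and> d (p (Suc i)) = d (p i) + w (p i, p (Suc i)))"

lemma tight_path_exists:
  assumes "root_dist E X w x d" "z \<in> X"
  obtains p m where "tight_path E X w x d p m" "p m = z"
proof -
  have "\<exists>p m. tight_path E X w x d p m \<and> p m = z" if "walk_cost (Restr E X) w x z c" "c \<le> d z" for z c
    using that
  proof (induction rule: walk_cost.induct)
    case walk_refl
    show ?case by (intro exI[of _ "\<lambda>_. x"] exI[of _ 0]) (auto simp: tight_path_def)
  next
    case (walk_step y c z)
    note L = root_distD(5)[OF assms(1) walk_step(2)] root_dist_walk_le[OF assms(1) walk_step(1)]
      root_distD(3)[OF assms(1)]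
    \<comment> \<open>Prefixes of shortest walks are shortest: a cheaper way to \<open>y\<close>
      would undercut \<open>d z\<close>.\<close>
    then have "c \<le> d y" using walk_step.prems by auto
    then obtain p m where p: "tight_path E X w x d p m" "p m = y" using walk_step.IH by auto
    have "tight_path E X w x d (p(Suc m := z)) (Suc m)"
      using p walk_step.hyps(2) walk_step.prems L by (auto simp: tight_path_def less_Suc_eq)
    then show ?case by (metis fun_upd_same)
  qed
  then show thesis using root_distD(4)[OF assms(1,2)] that by blast
qed

definition path_edges :: "(nat \<Rightarrow> 'v) \<Rightarrow> nat \<Rightarrow> 'v rel" where
  "path_edges p m = {(p i, p (Suc i)) |i. i < m} \<union> {(p (Suc i), p i) |i. i < m}"

lemma path_edges_sym: "(u, v) \<in> path_edges p m \<longleftrightarrow> (v, u) \<in> path_edges p m"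
  by (auto simp: path_edges_def)

section \<open>Petals\<close>

lemma tight_path_in:
  assumes "root_dist E X w x d" "tight_path E X w x d p m" "i \<le> m"
  shows "p i \<in> X"
proof (cases i)
  case 0
  then show ?thesis using assms root_distD(2)[OF assms(1)] by (auto simp: tight_path_def)
next
  case (Suc j)
  then show ?thesis using assms(2,3) by (auto simp: tight_path_def Suc_le_eq)
qed

lemma tight_path_mono:
  assumes "root_dist E X w x d" "tight_path E X w x d p m"
  shows "i \<le> j \<Longrightarrow> j \<le> m \<Longrightarrow> d (p i) \<le> d (p j)"
proof (induction j rule: dec_induct)
  case (step j)
  then have "(p j, p (Suc j)) \<in> Restr E X" "d (p (Suc j)) = d (p j) + w (p j, p (Suc j))"
    using assms(2) by (auto simp: tight_path_def)
  then show ?case using step root_distD(6)[OF assms(1), of "(p j, p (Suc j))"] by simp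
qed simp

lemma tight_path_prefix:
  assumes "tight_path E X w x d p m" "m1 \<le> m" "\<And>i. i \<le> m1 \<Longrightarrow> p i \<in> Y"
  shows "tight_path E Y w x d p m1"
  using assms by (auto simp: tight_path_def)

definition halve :: "(nat \<Rightarrow> 'v) \<Rightarrow> nat \<Rightarrow> ('v \<times> 'v \<Rightarrow> real) \<Rightarrow> 'v \<times> 'v \<Rightarrow> real" where
  "halve p m w e = (if e \<in> path_edges p m then w e / 2 else w e)"

text \<open>Halving the edges of a shortest path \<open>q\<close> shortens the distance of \<open>z\<close> to the root by the
  gain \<open>g z\<close>. The petals around the end of \<open>q\<close> are the superlevel sets of \<open>g\<close>: a halved shortest
  path to \<open>z\<close> follows \<open>q\<close> and then leaves it inside the petal, so what is lost by routing through
  \<open>q\<close> is made up for by the halving.\<close>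
locale petal =
  fixes E :: "'v rel" and X w x d q n d'
  assumes E_sym: "sym E"
    and w_sym: "(y, z) \<in> E \<Longrightarrow> w (y, z) = w (z, y)"
    and rd: "root_dist E X w x d"
    and tp: "tight_path E X w x d q n"
    and rd': "root_dist E X (halve q n w) x d'"
begin

definition g where "g z = d z - d' z"

lemma w_nonneg: "e \<in> Restr E X \<Longrightarrow> 0 \<le> w e"
  using root_distD(6)[OF rd] .

lemma halve_sym: "(y, z) \<in> E \<Longrightarrow> halve q n w (y, z) = halve q n w (z, y)"
  using w_sym[of y z] path_edges_sym[of y z] by (simp add: halve_def)

lemma halve_le: "e \<in> Restr E X \<Longrightarrow> halve q n w e \<le> w e"
  using w_nonneg[of e] by (auto simp: halve_def)

lemma halve_ge: "e \<in> Restr E X \<Longrightarrow> w e / 2 \<le> halve q n w e"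
  using w_nonneg[of e] by (auto simp: halve_def)

text \<open>\<open>d / 2\<close> is a feasible potential for the halved weights, since no weight
  drops below its half.\<close>

lemma d'_ge:
  assumes "z \<in> X"
  shows "d z / 2 \<le> d' z"
proof -
  have "d z / 2 \<le> d x / 2 + d' z"
  proof (rule walk_lipschitz[OF root_distD(4)[OF rd' assms]])
    fix y z assume "(y, z) \<in> Restr E X"
    then show "d z / 2 \<le> d y / 2 + halve q n w (y, z)"
      using root_distD(5)[OF rd, of y z] halve_ge[of "(y, z)"] by auto
  qed
  then show ?thesis using root_distD(3)[OF rd] by simp
qed

lemma g_le: "z \<in> X \<Longrightarrow> g z \<le> d z / 2"
  using d'_ge[of z] by (simp add: g_def field_simps)

lemma q_in: "i \<le> n \<Longrightarrow> q i \<in> X"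
  using tight_path_in[OF rd tp] .

lemma q0: "q 0 = x" using tp by (simp add: tight_path_def)

lemma q_edge: "i < n \<Longrightarrow> (q i, q (Suc i)) \<in> Restr E X"
  and q_step: "i < n \<Longrightarrow> d (q (Suc i)) = d (q i) + w (q i, q (Suc i))"
  using tp by (auto simp: tight_path_def)

lemma q_halved: "i < n \<Longrightarrow> halve q n w (q i, q (Suc i)) = (d (q (Suc i)) - d (q i)) / 2"
  using q_step[of i] by (auto simp: halve_def path_edges_def)

lemma d_mono: "i \<le> j \<Longrightarrow> j \<le> n \<Longrightarrow> d (q i) \<le> d (q j)"
  using tight_path_mono[OF rd tp] .

text \<open>The halved path gives the upper bound and \<open>d'_ge\<close> the lower one. On
  \<open>q\<close> the gain thus reaches the maximum that \<open>g_le\<close> allows.\<close>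

lemma d'_q: "i \<le> n \<Longrightarrow> d' (q i) = d (q i) / 2"
proof (induction i)
  case 0
  then show ?case using q0 root_distD(3)[OF rd] root_distD(3)[OF rd'] by simp
next
  case (Suc i)
  then have "d' (q (Suc i)) \<le> d (q (Suc i)) / 2"
    using root_distD(5)[OF rd' q_edge[of i]] q_halved[of i] by (simp add: field_simps)
  then show ?case using d'_ge[OF q_in[OF Suc.prems]] by simp
qed

lemma g_q: "i \<le> n \<Longrightarrow> g (q i) = d (q i) / 2"
  by (simp add: g_def d'_q)

text \<open>Both \<open>d\<close> and \<open>d'\<close> change by at most \<open>w (y, z)\<close>
  across an edge, in either direction; hence the factor 2.\<close>

lemma g_lipschitz:
  assumes "(y, z) \<in> Restr E X"
  shows "\<bar>g y - g z\<bar> \<le> 2 * w (y, z)"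
proof -
  have s: "(z, y) \<in> Restr E X" using assms E_sym by (auto dest: symD)
  have "w (z, y) = w (y, z)" using w_sym[of y z] assms by auto
  then show ?thesis
    using root_distD(5)[OF rd assms] root_distD(5)[OF rd s] root_distD(5)[OF rd' assms]
      root_distD(5)[OF rd' s] halve_le[OF assms] halve_le[OF s]
    by (simp add: g_def)
qed

text \<open>Along a shortest walk in \<open>w\<close>, each step raises \<open>d\<close> by the full
  weight of the edge and \<open>d'\<close> by at most that, so the gain never decreases. Sublevel
  sets of \<open>g\<close> therefore contain the shortest walks to their vertices, and the
  complement of a petal keeps its root distances.\<close>

lemma below_closed:
  assumes "walk_cost (Restr E X) w x z c" "c \<le> d z" "\<And>y. y \<in> X \<Longrightarrow> g y \<le> g z \<Longrightarrow> y \<in> S"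
  shows "walk_cost (Restr E S) w x z c"
  using assms
proof (induction rule: walk_cost.induct)
  case walk_refl
  show ?case by (rule walk_cost.walk_refl)
next
  case (walk_step y c z)
  have e: "y \<in> X" "z \<in> X" "(y, z) \<in> E" using walk_step by auto
  note L = root_distD(5)[OF rd walk_step(2)] root_dist_walk_from_root[OF rd walk_step(1)]
    root_distD(5)[OF rd' walk_step(2)] halve_le[OF walk_step(2)]
  have "g y \<le> g z" using L walk_step.prems by (simp add: g_def)
  then have "walk_cost (Restr E S) w x y c" "y \<in> S" "z \<in> S"
    using walk_step.prems L e by (force intro!: walk_step.IH)+
  then show ?case using e by (intro walk_cost.walk_step) auto
qed

lemma below_root_dist:
  assumes "0 < b"
  shows "root_dist E {z \<in> X. g z < b} w x d"
proof -
  have "walk_cost (Restr E {z \<in> X. g z < b}) w x z (d z)" if "z \<in> X" "g z < b" for z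
    using that by (intro below_closed[OF root_distD(4)[OF rd]]) auto
  moreover have "g x = 0" using root_distD(3)[OF rd] root_distD(3)[OF rd'] by (simp add: g_def)
  moreover have "d z \<le> d y + w (y, z) \<and> 0 \<le> w (y, z)" if "(y, z) \<in> Restr E X" for y z
    using root_distD(5,6)[OF rd that] by simp
  ultimately show ?thesis
    using root_distD(1-3)[OF rd] assms by (auto simp: root_dist_def)
qed

lemma along_path:
  assumes "i \<le> j" "j \<le> n" "\<And>y. y \<in> X \<Longrightarrow> g (q i) \<le> g y \<Longrightarrow> y \<in> S"
  shows "walk_cost (Restr E S) w (q i) (q j) (d (q j) - d (q i))"
    and "walk_cost (Restr E S) (halve q n w) (q i) (q j) (d' (q j) - d' (q i))"
proof -
  have S: "q k \<in> S" if "i \<le> k" "k \<le> n" for k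
    using that g_q[of k] g_q[of i] d_mono[of i k] by (intro assms(3) q_in) auto
  have "walk_cost (Restr E S) w (q i) (q j) (d (q j) - d (q i)) \<and>
      walk_cost (Restr E S) (halve q n w) (q i) (q j) (d' (q j) - d' (q i))"
    using assms(1,2)
  proof (induction j rule: dec_induct)
    case base
    show ?case by (simp add: walk_refl)
  next
    case (step j)
    have e: "(q j, q (Suc j)) \<in> Restr E S" using q_edge[of j] S[of j] S[of "Suc j"] step by auto
    from step have "walk_cost (Restr E S) w (q i) (q j) (d (q j) - d (q i))"
      "walk_cost (Restr E S) (halve q n w) (q i) (q j) (d' (q j) - d' (q i))" by auto
    note this[THEN walk_step[OF _ e]]
    moreover have "d (q j) - d (q i) + w (q j, q (Suc j)) = d (q (Suc j)) - d (q i)"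
      using q_step[of j] step by simp
    moreover have "d' (q j) - d' (q i) + halve q n w (q j, q (Suc j)) = d' (q (Suc j)) - d' (q i)"
      using q_halved[of j] d'_q[of j] d'_q[of "Suc j"] step by (simp add: field_simps)
    ultimately show ?case by simp
  qed
  then show "walk_cost (Restr E S) w (q i) (q j) (d (q j) - d (q i))"
    "walk_cost (Restr E S) (halve q n w) (q i) (q j) (d' (q j) - d' (q i))" by auto
qed

text \<open>The mirror image of \<open>below_closed\<close>: a step of a halved shortest walk to a
  vertex off \<open>q\<close> crosses an unhalved edge, so \<open>d'\<close> rises by its weight,
  \<open>d\<close> by at most that, and the gain does not increase. After its last visit to
  \<open>q\<close> the walk stays in the superlevel set of \<open>g z\<close> and costs the same in
  both weights. Meeting \<open>q\<close> again restarts the argument with an empty tail;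
  \<open>S\<close> is quantified inside because the superlevel set changes with the
  endpoint.\<close>

lemma leave_path:
  assumes "walk_cost (Restr E X) (halve q n w) x z c" "c \<le> d' z"
  shows "\<exists>j\<le>n. g z \<le> g (q j) \<and> (\<forall>S. {y \<in> X. g z \<le> g y} \<subseteq> S \<longrightarrow>
    walk_cost (Restr E S) w (q j) z (d' z - d' (q j)) \<and>
    walk_cost (Restr E S) (halve q n w) (q j) z (d' z - d' (q j)))"
  using assms
proof (induction rule: walk_cost.induct)
  case walk_refl
  show ?case by (intro exI[of _ 0]) (auto simp: q0 intro: walk_cost.walk_refl)
next
  case (walk_step y c z)
  show ?case
  proof (cases "\<exists>j\<le>n. z = q j")
    case True
    then obtain j where "j \<le> n" "z = q j" by blast
    then show ?thesis by (intro exI[of _ j]) (simp add: walk_cost.walk_refl)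
  next
    case False
    have e: "y \<in> X" "z \<in> X" "(y, z) \<in> E" using walk_step by auto
    have "(y, z) \<notin> path_edges q n"
      unfolding path_edges_def using False less_imp_le Suc_leI by blast
    then have "halve q n w (y, z) = w (y, z)" by (simp add: halve_def)
    note L = root_distD(5)[OF rd walk_step(2)] root_dist_walk_from_root[OF rd' walk_step(1)]
      root_distD(5)[OF rd' walk_step(2)] this
    have gz: "g z \<le> g y" and d'z: "d' z = d' y + w (y, z)" and "c \<le> d' y"
      using L walk_step.prems by (auto simp: g_def)
    from walk_step.IH[OF this(3)] obtain j where j: "j \<le> n" "g y \<le> g (q j)"
      "\<And>S. {v \<in> X. g y \<le> g v} \<subseteq> S \<Longrightarrow> walk_cost (Restr E S) w (q j) y (d' y - d' (q j))"
      "\<And>S. {v \<in> X. g y \<le> g v} \<subseteq> S \<Longrightarrow> walk_cost (Restr E S) (halve q n w) (q j) y (d' y - d' (q j))"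
      by blast
    have "walk_cost (Restr E S) w (q j) z (d' z - d' (q j)) \<and>
        walk_cost (Restr E S) (halve q n w) (q j) z (d' z - d' (q j))"
      if S: "{v \<in> X. g z \<le> g v} \<subseteq> S" for S
    proof -
      have S': "{v \<in> X. g y \<le> g v} \<subseteq> S" using S gz by force
      have e': "(y, z) \<in> Restr E S" using S e gz by auto
      from walk_cost.walk_step[OF j(3)[OF S'] e'] walk_cost.walk_step[OF j(4)[OF S'] e'] show ?thesis
        using L(4) d'z by (simp add: algebra_simps)
    qed
    then show ?thesis using j gz by (intro exI[of _ j]) auto
  qed
qed

end

section \<open>The larger petal as a cluster with its own root\<close>

locale petal_cut = petal +
  fixes a :: real and i1 :: nat
  assumes a_pos: "0 < a" and i1: "i1 \<le> n" "a \<le> g (q i1)" "\<And>i. i < i1 \<Longrightarrow> g (q i) < a"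
begin

abbreviation "A \<equiv> {z \<in> X. a \<le> g z}"

lemma i1_pos: "0 < i1"
  using i1 a_pos q0 root_distD(3)[OF rd] root_distD(3)[OF rd'] by (intro gr0I) (simp add: g_def)

lemma q_in_A_iff: "i \<le> n \<Longrightarrow> q i \<in> A \<longleftrightarrow> i1 \<le> i"
  using i1(2) i1(3)[of i] g_q[of i] g_q[OF i1(1)] d_mono[of i1 i] q_in[of i]
  by (cases "i1 \<le> i") auto

text \<open>Follow \<open>q\<close> from \<open>q i1\<close> to the vertex \<open>q j\<close> given
  by \<open>leave_path\<close>, then take its tail. In halved weights the two costs telescope; in
  \<open>w\<close> only the stretch of \<open>q\<close> is more expensive, by half of its length,
  which is bounded through \<open>d (q n)\<close>.\<close>

lemma reach:
  assumes "z \<in> A"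
  shows "walk_cost (Restr E A) (halve q n w) (q i1) z (d' z - d' (q i1))"
    and "\<exists>c \<le> d' z + d (q n) / 2 - d (q i1). walk_cost (Restr E A) w (q i1) z c"
proof -
  have "z \<in> X" "{y \<in> X. g z \<le> g y} \<subseteq> A" using assms by auto
  then obtain j where j: "j \<le> n" "g z \<le> g (q j)"
    "walk_cost (Restr E A) w (q j) z (d' z - d' (q j))"
    "walk_cost (Restr E A) (halve q n w) (q j) z (d' z - d' (q j))"
    using leave_path[OF root_distD(4)[OF rd' \<open>z \<in> X\<close>] order_refl] by meson
  have "i1 \<le> j" using q_in_A_iff[of j] j q_in[of j] assms by auto
  have *: "walk_cost (Restr E A) w (q i1) (q j) (d (q j) - d (q i1))"
    "walk_cost (Restr E A) (halve q n w) (q i1) (q j) (d' (q j) - d' (q i1))"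
    using along_path[OF \<open>i1 \<le> j\<close> j(1), of A] i1 by auto
  show "walk_cost (Restr E A) (halve q n w) (q i1) z (d' z - d' (q i1))"
    using walk_trans[OF j(4) *(2)] by simp
  show "\<exists>c \<le> d' z + d (q n) / 2 - d (q i1). walk_cost (Restr E A) w (q i1) z c"
  proof (intro exI conjI)
    show "walk_cost (Restr E A) w (q i1) z (d (q j) - d (q i1) + (d' z - d' (q j)))"
      by (rule walk_trans[OF j(3) *(1)])
    show "d (q j) - d (q i1) + (d' z - d' (q j)) \<le> d' z + d (q n) / 2 - d (q i1)"
      using d'_q[OF j(1)] d_mono[OF j(1)] by simp
  qed
qed

lemma root_dist_halved: "root_dist E A (halve q n w) (q i1) (\<lambda>z. d' z - d' (q i1))"
  unfolding root_dist_def
proof (intro conjI)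
  show "finite A" using root_distD(1)[OF rd] by simp
  show "q i1 \<in> A" using i1 q_in by auto
  show "\<forall>z\<in>A. walk_cost (Restr E A) (halve q n w) (q i1) z (d' z - d' (q i1))" using reach(1) by blast
  show "\<forall>(y, z)\<in>Restr E A. d' z - d' (q i1) \<le> d' y - d' (q i1) + halve q n w (y, z) \<and>
      0 \<le> halve q n w (y, z)"
    using root_distD(5,6)[OF rd'] by force
qed simp

lemma root_dist_petal:
  obtains dA where "root_dist E A w (q i1) dA"
    "\<And>z. z \<in> A \<Longrightarrow> dA z \<le> d' z + d (q n) / 2 - d (q i1)"
    "\<And>i. i1 \<le> i \<Longrightarrow> i \<le> n \<Longrightarrow> dA (q i) = d (q i) - d (q i1)"
proof -
  obtain dA where dA: "root_dist E A w (q i1) dA"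
  proof (rule root_dist_exists)
    show "finite A" using root_distD(1)[OF rd] by simp
    show "q i1 \<in> A" using i1 q_in by auto
    show "\<exists>c. walk_cost (Restr E A) w (q i1) z c" if "z \<in> A" for z using reach(2)[OF that] by auto
    show "0 \<le> w e" if "e \<in> Restr E A" for e using w_nonneg[of e] that by auto
  qed
  moreover have "dA z \<le> d' z + d (q n) / 2 - d (q i1)" if "z \<in> A" for z
    using reach(2)[OF that] root_dist_walk_from_root[OF dA] by force
  moreover have "dA (q i) = d (q i) - d (q i1)" if "i1 \<le> i" "i \<le> n" for i
  proof (rule antisym)
    show "dA (q i) \<le> d (q i) - d (q i1)"
      using along_path(1)[OF that, of A] i1 by (intro root_dist_walk_from_root[OF dA]) auto
    have "q i \<in> A" using that q_in_A_iff by auto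
    have "d (q i) \<le> d (q i1) + dA (q i)"
      by (rule walk_lipschitz[OF root_distD(4)[OF dA \<open>q i \<in> A\<close>]]) (use root_distD(5)[OF rd] in auto)
    then show "d (q i) - d (q i1) \<le> dA (q i)" by simp
  qed
  ultimately show thesis using that by blast
qed

text \<open>The gain grows along \<open>q\<close>, so \<open>q\<close> meets the petal in a suffix.
  The recursion needs this to keep all reduced edges of the petal on the path handed to it.\<close>

lemma path_shift_edges:
  assumes "e \<in> Restr E A" "e \<in> path_edges q n"
  shows "e \<in> path_edges (\<lambda>i. q (i + i1)) (n - i1)"
proof -
  obtain i where i: "i < n" "e = (q i, q (Suc i)) \<or> e = (q (Suc i), q i)"
    using assms(2) by (auto simp: path_edges_def)
  then have "q i \<in> A" using assms(1) by auto
  then have "i1 \<le> i" using q_in_A_iff[of i] i by auto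
  then show ?thesis using i unfolding path_edges_def
    by (auto intro!: exI[of _ "i - i1"])
qed

lemma tight_path_halved:
  "tight_path E A (halve q n w) (q i1) (\<lambda>z. d' z - d' (q i1)) (\<lambda>i. q (i + i1)) (n - i1)"
  unfolding tight_path_def
proof (intro conjI allI impI)
  fix i assume "i < n - i1"
  then have i: "i + i1 < n" by simp
  show "(q (i + i1), q (Suc i + i1)) \<in> Restr E A"
    using q_edge[OF i] q_in_A_iff[of "i + i1"] q_in_A_iff[of "Suc i + i1"] i by auto
  show "d' (q (Suc i + i1)) - d' (q i1) = d' (q (i + i1)) - d' (q i1) + halve q n w (q (i + i1), q (Suc i + i1))"
    using q_halved[OF i] d'_q[of "i + i1"] d'_q[of "Suc i + i1"] i by (simp add: field_simps)
qed simp

lemma tight_path_petal: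
  assumes "\<And>i. i1 \<le> i \<Longrightarrow> i \<le> n \<Longrightarrow> dA (q i) = d (q i) - d (q i1)"
  shows "tight_path E A w (q i1) dA (\<lambda>i. q (i + i1)) (n - i1)"
  unfolding tight_path_def
proof (intro conjI allI impI)
  fix i assume "i < n - i1"
  then have i: "i + i1 < n" by simp
  show "(q (i + i1), q (Suc i + i1)) \<in> Restr E A"
    using q_edge[OF i] q_in_A_iff[of "i + i1"] q_in_A_iff[of "Suc i + i1"] i by auto
  show "dA (q (Suc i + i1)) = dA (q (i + i1)) + w (q (i + i1), q (Suc i + i1))"
    using q_step[OF i] assms[of "i + i1"] assms[of "Suc i + i1"] i by simp
qed simp

end

section \<open>Clan trees\<close>

definition tree_edges :: "nat set \<Rightarrow> nat \<Rightarrow> (nat \<Rightarrow> nat) \<Rightarrow> nat rel" where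
  "tree_edges V r par = {(z, par z) |z. z \<in> V - {r}} \<union> {(par z, z) |z. z \<in> V - {r}}"

definition pull_weight :: "('v \<times> 'v \<Rightarrow> real) \<Rightarrow> (nat \<Rightarrow> 'v) \<Rightarrow> nat \<times> nat \<Rightarrow> real" where
  "pull_weight w lab e = w (lab (fst e), lab (snd e))"

text \<open>\<open>dep\<close> is the depth of a node when every edge counts with at least half of its weight, and
  \<open>lev\<close> only witnesses that following \<open>par\<close> reaches the root.\<close>
definition labelled_tree ::
  "'v rel \<Rightarrow> ('v \<times> 'v \<Rightarrow> real) \<Rightarrow> nat set \<Rightarrow> nat \<Rightarrow> (nat \<Rightarrow> 'v) \<Rightarrow> (nat \<Rightarrow> nat) \<Rightarrow> (nat \<Rightarrow> real) \<Rightarrow>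
   (nat \<Rightarrow> nat) \<Rightarrow> bool" where
  "labelled_tree E w V r lab par dep lev \<longleftrightarrow> finite V \<and> r \<in> V \<and> dep r = 0 \<and>
     (\<forall>z\<in>V - {r}. par z \<in> V \<and> lev (par z) < lev z \<and> (lab (par z), lab z) \<in> E \<and>
        w (lab (par z), lab z) \<le> 2 * (dep z - dep (par z)))"

lemma labelled_treeD:
  assumes "labelled_tree E w V r lab par dep lev"
  shows "finite V" "r \<in> V" "dep r = 0" "z \<in> V \<Longrightarrow> z \<noteq> r \<Longrightarrow> par z \<in> V"
    "z \<in> V \<Longrightarrow> z \<noteq> r \<Longrightarrow> lev (par z) < lev z"
    "z \<in> V \<Longrightarrow> z \<noteq> r \<Longrightarrow> (lab (par z), lab z) \<in> E"
    "z \<in> V \<Longrightarrow> z \<noteq> r \<Longrightarrow> w (lab (par z), lab z) \<le> 2 * (dep z - dep (par z))"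
  using assms by (auto simp: labelled_tree_def)

lemma tree_edges_sym: "sym (tree_edges V r par)"
  by (auto simp: tree_edges_def sym_def)

lemma tree_edges_mono:
  assumes "\<And>z. z \<in> V \<Longrightarrow> z \<noteq> r \<Longrightarrow> z \<in> V' \<and> z \<noteq> r' \<and> par' z = par z"
  shows "tree_edges V r par \<subseteq> tree_edges V' r' par'"
proof
  fix e assume "e \<in> tree_edges V r par"
  then obtain z where z: "z \<in> V" "z \<noteq> r" "e = (z, par z) \<or> e = (par z, z)"
    by (auto simp: tree_edges_def)
  then have "e = (z, par' z) \<or> e = (par' z, z)" "z \<in> V' - {r'}" using assms[OF z(1,2)] by auto
  then show "e \<in> tree_edges V' r' par'" unfolding tree_edges_def by blast
qed

lemma tree_edges_nodes:
  assumes "labelled_tree E w V r lab par dep lev" "e \<in> tree_edges V r par"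
  shows "fst e \<in> V \<and> snd e \<in> V"
  using assms(2) labelled_treeD(4)[OF assms(1)] by (force simp: tree_edges_def)

lemma tree_edges_lab:
  assumes "labelled_tree E w V r lab par dep lev" "sym E" "(a, b) \<in> tree_edges V r par"
  shows "(lab a, lab b) \<in> E"
  using assms labelled_treeD(6)[OF assms(1)] by (auto simp: tree_edges_def dest: symD)

lemma tree_root_walk:
  assumes "labelled_tree E w V r lab par dep lev" "z \<in> V"
  shows "\<exists>c \<le> 2 * dep z. walk_cost (tree_edges V r par) (pull_weight w lab) r z c"
  using assms(2)
proof (induction "lev z" arbitrary: z rule: less_induct)
  case less
  show ?case
  proof (cases "z = r")
    case True
    then show ?thesis using labelled_treeD(3)[OF assms(1)] by (intro exI[of _ 0]) (auto intro: walk_refl)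
  next
    case False
    note T = labelled_treeD(4,5,7)[OF assms(1) less.prems False]
    obtain c where c: "c \<le> 2 * dep (par z)" "walk_cost (tree_edges V r par) (pull_weight w lab) r (par z) c"
      using less.hyps[OF T(2,1)] by blast
    have "(par z, z) \<in> tree_edges V r par" using less.prems False by (auto simp: tree_edges_def)
    from walk_step[OF c(2) this] show ?thesis using c(1) T(3)
      by (intro exI[of _ "c + pull_weight w lab (par z, z)"]) (auto simp: pull_weight_def)
  qed
qed

lemma tree_walk:
  assumes "labelled_tree E w V r lab par dep lev" "sym E" "\<And>y z. (y, z) \<in> E \<Longrightarrow> w (y, z) = w (z, y)"
    "u \<in> V" "v \<in> V"
  shows "\<exists>c \<le> 2 * (dep u + dep v). walk_cost (tree_edges V r par) (pull_weight w lab) u v c"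
proof -
  obtain c where c: "c \<le> 2 * dep u" "walk_cost (tree_edges V r par) (pull_weight w lab) r u c"
    using tree_root_walk[OF assms(1,4)] by blast
  obtain c' where c': "c' \<le> 2 * dep v" "walk_cost (tree_edges V r par) (pull_weight w lab) r v c'"
    using tree_root_walk[OF assms(1,5)] by blast
  have "walk_cost (tree_edges V r par) (pull_weight w lab) u r c"
    using c(2) tree_edges_sym
  proof (rule walk_rev)
    show "pull_weight w lab (y, z) = pull_weight w lab (z, y)" if "(y, z) \<in> tree_edges V r par" for y z
      using assms(3)[OF tree_edges_lab[OF assms(1,2) that]] by (simp add: pull_weight_def)
  qed
  from walk_trans[OF c'(2) this] show ?thesis using c c' by (intro exI[of _ "c + c'"]) auto
qed

text \<open>Walks of the cluster are priced in its current weights \<open>w\<close>, tree walks in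
  the original weights \<open>w0\<close>. The distortion is demanded for all walks rather than for
  distances, so a walk that survives inside a subcluster can be passed on directly.\<close>

definition clan_tree ::
  "'v rel \<Rightarrow> ('v \<times> 'v \<Rightarrow> real) \<Rightarrow> 'v set \<Rightarrow> ('v \<times> 'v \<Rightarrow> real) \<Rightarrow> real \<Rightarrow> nat set \<Rightarrow> nat \<Rightarrow> (nat \<Rightarrow> 'v) \<Rightarrow>
   (nat \<Rightarrow> nat) \<Rightarrow> (nat \<Rightarrow> real) \<Rightarrow> (nat \<Rightarrow> nat) \<Rightarrow> ('v \<Rightarrow> nat) \<Rightarrow> bool" where
  "clan_tree E w0 X w t V r lab par dep lev chi \<longleftrightarrow>
     labelled_tree E w0 V r lab par dep lev \<and> lab ` V = X \<and> (\<forall>v\<in>X. chi v \<in> V \<and> lab (chi v) = v) \<and>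
     (\<forall>u\<in>X. \<forall>v c. walk_cost (Restr E X) w u v c \<longrightarrow>
        (\<exists>u'\<in>V. lab u' = u \<and>
           (\<exists>c' \<le> t * c. walk_cost (tree_edges V r par) (pull_weight w0 lab) u' (chi v) c')))"

text \<open>The induction hypothesis. The path \<open>p\<close> whose distances are preserved exactly is the one along
  which the petal was attached to the rest of the graph. The names of the nodes start at \<open>N\<close>, so that
  disjoint trees can be requested.\<close>
definition rooted_clan ::
  "'v rel \<Rightarrow> ('v \<times> 'v \<Rightarrow> real) \<Rightarrow> ('v \<Rightarrow> real) \<Rightarrow> real \<Rightarrow> nat \<Rightarrow> 'v set \<Rightarrow> ('v \<times> 'v \<Rightarrow> real) \<Rightarrow> 'v \<Rightarrow>
   ('v \<Rightarrow> real) \<Rightarrow> (nat \<Rightarrow> 'v) \<Rightarrow> nat \<Rightarrow> real \<Rightarrow> bool" where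
  "rooted_clan E w0 mu t N X w x d p m B \<longleftrightarrow>
     (\<exists>V r lab par dep lev chi. clan_tree E w0 X w t V r lab par dep lev chi \<and>
        (\<forall>z\<in>V. N \<le> z) \<and> lab r = x \<and> (\<forall>z\<in>V. dep z \<le> 2 * d (lab z)) \<and>
        (\<forall>i\<le>m. \<exists>z\<in>V. lab z = p i \<and> dep z \<le> d (p i)) \<and> (\<Sum>z\<in>V. mu (lab z)) \<le> B)"

lemma rooted_clan_mono:
  "rooted_clan E w0 mu t N X w x d p m B \<Longrightarrow> B \<le> B' \<Longrightarrow> rooted_clan E w0 mu t N X w x d p m B'"
  unfolding rooted_clan_def
  by (elim exE conjE, intro exI conjI, assumption+, erule (1) order_trans)

lemma labelled_tree_join:
  assumes T1: "labelled_tree E w0 V1 r1 lab1 par1 dep1 lev1"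
    and T2: "labelled_tree E w0 V2 r2 lab2 par2 dep2 lev2"
    and disj: "V1 \<inter> V2 = {}" and y: "y \<in> V1"
    and e: "(lab1 y, lab2 r2) \<in> E" "w0 (lab1 y, lab2 r2) \<le> 2 * s"
    and lab_def: "lab = (\<lambda>z. if z \<in> V1 then lab1 z else lab2 z)"
    and par_def: "par = (\<lambda>z. if z \<in> V1 then par1 z else if z = r2 then y else par2 z)"
    and dep_def: "dep = (\<lambda>z. if z \<in> V1 then dep1 z else dep1 y + s + dep2 z)"
    and lev_def: "lev = (\<lambda>z. if z \<in> V1 then lev1 z else Suc (lev1 y + lev2 z))"
  shows "labelled_tree E w0 (V1 \<union> V2) r1 lab par dep lev"
    and "walk_cost (tree_edges V1 r1 par1) (pull_weight w0 lab1) u v c \<Longrightarrow>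
      walk_cost (tree_edges (V1 \<union> V2) r1 par) (pull_weight w0 lab) u v c"
    and "walk_cost (tree_edges V2 r2 par2) (pull_weight w0 lab2) u v c \<Longrightarrow>
      walk_cost (tree_edges (V1 \<union> V2) r1 par) (pull_weight w0 lab) u v c"
proof -
  have V2: "z \<notin> V1" if "z \<in> V2" for z using disj that by auto
  note D1 = labelled_treeD[OF T1] and D2 = labelled_treeD[OF T2]
  have node: "par z \<in> V1 \<union> V2 \<and> lev (par z) < lev z \<and> (lab (par z), lab z) \<in> E \<and>
        w0 (lab (par z), lab z) \<le> 2 * (dep z - dep (par z))" if z: "z \<in> V1 \<union> V2" "z \<noteq> r1" for z
  proof (cases "z \<in> V1")
    case True
    then show ?thesis using D1(4-7)[OF True z(2)] by (simp add: lab_def par_def dep_def lev_def)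
  next
    case False
    then have z2: "z \<in> V2" using z by auto
    show ?thesis
    proof (cases "z = r2")
      case True
      then show ?thesis using False y e D2(3) by (simp add: lab_def par_def dep_def lev_def)
    next
      case neq: False
      show ?thesis using False neq D2(4-7)[OF z2 neq] V2[OF D2(4)[OF z2 neq]]
        by (simp add: lab_def par_def dep_def lev_def)
    qed
  qed
  then show "labelled_tree E w0 (V1 \<union> V2) r1 lab par dep lev"
    using D1(1-3) D2(1) by (simp add: labelled_tree_def dep_def)
  show "walk_cost (tree_edges (V1 \<union> V2) r1 par) (pull_weight w0 lab) u v c"
    if "walk_cost (tree_edges V1 r1 par1) (pull_weight w0 lab1) u v c"
    using that
  proof (rule walk_mono)
    show "tree_edges V1 r1 par1 \<subseteq> tree_edges (V1 \<union> V2) r1 par"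
      by (rule tree_edges_mono) (simp add: par_def)
    show "pull_weight w0 lab e = pull_weight w0 lab1 e" if "e \<in> tree_edges V1 r1 par1" for e
      using tree_edges_nodes[OF T1 that] by (simp add: pull_weight_def lab_def)
  qed
  show "walk_cost (tree_edges (V1 \<union> V2) r1 par) (pull_weight w0 lab) u v c"
    if "walk_cost (tree_edges V2 r2 par2) (pull_weight w0 lab2) u v c"
    using that
  proof (rule walk_mono)
    show "tree_edges V2 r2 par2 \<subseteq> tree_edges (V1 \<union> V2) r1 par"
      using V2 D1(2) by (intro tree_edges_mono) (auto simp: par_def)
    show "pull_weight w0 lab e = pull_weight w0 lab2 e" if "e \<in> tree_edges V2 r2 par2" for e
      using tree_edges_nodes[OF T2 that] V2 by (simp add: pull_weight_def lab_def)
  qed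
qed

text \<open>The second tree is hung below a node over \<open>y1\<close> of depth at most
  \<open>D0\<close>: in general twice the root distance, but only \<open>d y1\<close> if
  \<open>y1\<close> lies on the preserved path. \<open>s\<close> is the depth charged for the
  connecting edge, \<open>C\<close> selects the side of the chief, and \<open>R\<close> bounds all
  tree distances, which settles expensive walks at once.\<close>

lemma rooted_clan_join:
  assumes Y: "\<And>N. rooted_clan E w0 mu t N Y w x d p1 m1 B1"
    and A: "\<And>N. rooted_clan E w0 mu t N A wA x1 dA p2 m2 B2"
    and E: "sym E" "\<And>y z. (y, z) \<in> E \<Longrightarrow> w0 (y, z) = w0 (z, y)"
    and X: "X = Y \<union> A"
    and e: "(y1, x1) \<in> E" "w0 (y1, x1) \<le> 2 * s"
    and attach: "y1 \<in> Y \<and> D0 = 2 * d y1 \<or> (\<exists>i\<le>m1. y1 = p1 i \<and> D0 = d y1)"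
    and depth: "\<And>z. z \<in> A \<Longrightarrow> D0 + s + 2 * dA z \<le> 2 * d z"
    and path: "\<And>i. i \<le> m \<Longrightarrow> (\<exists>j\<le>m1. p i = p1 j) \<or> (\<exists>j\<le>m2. p i = p2 j \<and> D0 + s + dA (p i) \<le> d (p i))"
    and wA: "\<And>e. e \<in> Restr E A \<Longrightarrow> wA e \<le> w e" and t: "0 \<le> t"
    and C: "\<And>v. v \<in> X \<Longrightarrow> C v \<Longrightarrow> v \<in> A" "\<And>v. v \<in> X \<Longrightarrow> \<not> C v \<Longrightarrow> v \<in> Y"
    and R: "\<And>z. z \<in> X \<Longrightarrow> 8 * d z \<le> R"
    and sep: "\<And>u v c. u \<in> X \<Longrightarrow> walk_cost (Restr E X) w u v c \<Longrightarrow> R \<le> t * c \<or>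
      (if C v then u \<in> A \<and> walk_cost (Restr E A) w u v c else u \<in> Y \<and> walk_cost (Restr E Y) w u v c)"
  shows "rooted_clan E w0 mu t N X w x d p m (B1 + B2)"
proof -
  obtain V1 r1 lab1 par1 dep1 lev1 chi1 where T1: "clan_tree E w0 Y w t V1 r1 lab1 par1 dep1 lev1 chi1"
    and N1: "\<And>z. z \<in> V1 \<Longrightarrow> N \<le> z" and r1: "lab1 r1 = x"
    and dep1: "\<And>z. z \<in> V1 \<Longrightarrow> dep1 z \<le> 2 * d (lab1 z)"
    and p1: "\<And>i. i \<le> m1 \<Longrightarrow> \<exists>z\<in>V1. lab1 z = p1 i \<and> dep1 z \<le> d (p1 i)"
    and B1: "(\<Sum>z\<in>V1. mu (lab1 z)) \<le> B1"
    using Y[of N] unfolding rooted_clan_def by blast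
  have LT1: "labelled_tree E w0 V1 r1 lab1 par1 dep1 lev1" using T1 by (simp add: clan_tree_def)
  define N' where "N' = N + Suc (Max V1)"
  obtain V2 r2 lab2 par2 dep2 lev2 chi2 where T2: "clan_tree E w0 A wA t V2 r2 lab2 par2 dep2 lev2 chi2"
    and N2: "\<And>z. z \<in> V2 \<Longrightarrow> N' \<le> z" and r2: "lab2 r2 = x1"
    and dep2: "\<And>z. z \<in> V2 \<Longrightarrow> dep2 z \<le> 2 * dA (lab2 z)"
    and p2: "\<And>i. i \<le> m2 \<Longrightarrow> \<exists>z\<in>V2. lab2 z = p2 i \<and> dep2 z \<le> dA (p2 i)"
    and B2: "(\<Sum>z\<in>V2. mu (lab2 z)) \<le> B2"
    using A[of N'] unfolding rooted_clan_def by blast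
  have LT2: "labelled_tree E w0 V2 r2 lab2 par2 dep2 lev2" using T2 by (simp add: clan_tree_def)
  have V2: "z \<notin> V1" if "z \<in> V2" for z
    using N2[OF that] Max_ge[OF labelled_treeD(1)[OF LT1], of z] by (auto simp: N'_def)
  then have disj: "V1 \<inter> V2 = {}" by auto
  obtain y where y: "y \<in> V1" "lab1 y = y1" "dep1 y \<le> D0"
  proof (cases "y1 \<in> Y \<and> D0 = 2 * d y1")
    case True
    then obtain y where "y \<in> V1" "lab1 y = y1" using T1 by (auto simp: clan_tree_def)
    then show thesis using dep1[of y] True that by auto
  next
    case False
    then obtain i where "i \<le> m1" "y1 = p1 i" "D0 = d y1" using attach by blast
    then show thesis using p1[of i] that by auto
  qed
  define lab where "lab = (\<lambda>z. if z \<in> V1 then lab1 z else lab2 z)"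
  define par where "par = (\<lambda>z. if z \<in> V1 then par1 z else if z = r2 then y else par2 z)"
  define dep where "dep = (\<lambda>z. if z \<in> V1 then dep1 z else dep1 y + s + dep2 z)"
  define lev where "lev = (\<lambda>z. if z \<in> V1 then lev1 z else Suc (lev1 y + lev2 z))"
  define chi where "chi v = (if C v then chi2 v else chi1 v)" for v
  note join = labelled_tree_join[OF LT1 LT2 disj y(1) e[folded y(2) r2] lab_def par_def dep_def lev_def]
  have lab1: "lab z = lab1 z" if "z \<in> V1" for z using that by (simp add: lab_def)
  have lab2: "lab z = lab2 z" if "z \<in> V2" for z using V2[OF that] by (simp add: lab_def)
  have depth': "dep z \<le> D0 + s + dep2 z" if "z \<in> V2" for z
    using V2[OF that] y(3) by (simp add: dep_def)
  have dep: "dep z \<le> 2 * d (lab z)" if "z \<in> V1 \<union> V2" for z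
  proof (cases "z \<in> V1")
    case True
    then show ?thesis using dep1 by (simp add: lab_def dep_def)
  next
    case False
    then have z: "z \<in> V2" using that by auto
    then have "lab2 z \<in> A" using T2 by (auto simp: clan_tree_def)
    then show ?thesis using depth'[OF z] dep2[OF z] depth[of "lab2 z"] lab2[OF z] by simp
  qed
  have img: "lab ` (V1 \<union> V2) = X"
    using T1 T2 lab1 lab2 by (auto simp: clan_tree_def X image_Un)
  have chi: "chi v \<in> V1 \<union> V2 \<and> lab (chi v) = v" if "v \<in> X" for v
  proof (cases "C v")
    case True
    then have "chi2 v \<in> V2 \<and> lab2 (chi2 v) = v" using C(1)[OF that] T2 by (auto simp: clan_tree_def)
    then show ?thesis using True lab2 by (simp add: chi_def)
  next
    case False
    then have "chi1 v \<in> V1 \<and> lab1 (chi1 v) = v" using C(2)[OF that] T1 by (auto simp: clan_tree_def)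
    then show ?thesis using False lab1 by (simp add: chi_def)
  qed
  have dist: "\<exists>u'\<in>V1 \<union> V2. lab u' = u \<and> (\<exists>c' \<le> t * c.
      walk_cost (tree_edges (V1 \<union> V2) r1 par) (pull_weight w0 lab) u' (chi v) c')"
    if u: "u \<in> X" and walk: "walk_cost (Restr E X) w u v c" for u v c
  proof -
    consider "R \<le> t * c" | "C v" "u \<in> A" "walk_cost (Restr E A) w u v c"
      | "\<not> C v" "u \<in> Y" "walk_cost (Restr E Y) w u v c"
      using sep[OF u walk] by (auto split: if_splits)
    then show ?thesis
    proof cases
      \<comment> \<open>Two nodes are joined through the root at cost at most
        \<open>2 * (dep u' + dep (chi v))\<close>. With depth at most \<open>2 * d\<close> and
        \<open>8 * d \<le> R\<close> this is at most \<open>R\<close>.\<close>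
      case 1
      have v: "v \<in> X" using walk_in[OF walk u] .
      obtain u' where u': "u' \<in> V1 \<union> V2" "lab u' = u" using img u by (metis imageE)
      obtain c' where c': "c' \<le> 2 * (dep u' + dep (chi v))"
        "walk_cost (tree_edges (V1 \<union> V2) r1 par) (pull_weight w0 lab) u' (chi v) c'"
        using tree_walk[OF join(1) E u'(1) conjunct1[OF chi[OF v]]] by blast
      have "c' \<le> t * c"
        using c'(1) dep[OF u'(1)] dep[OF conjunct1[OF chi[OF v]]] R[OF u] R[OF v] u'(2) chi[OF v] 1
        by simp
      then show ?thesis using u' c' by blast
    next
      case 2
      obtain c1 where c1: "c1 \<le> c" "walk_cost (Restr E A) wA u v c1" using walk_cheaper[OF 2(3) wA] .
      then obtain u' c' where "u' \<in> V2" "lab2 u' = u" "c' \<le> t * c1"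
        "walk_cost (tree_edges V2 r2 par2) (pull_weight w0 lab2) u' (chi2 v) c'"
        using T2 2(2) unfolding clan_tree_def by blast
      moreover have "t * c1 \<le> t * c" using c1 t by (simp add: mult_left_mono)
      ultimately show ?thesis using join(3) lab2 2(1)
        by (intro bexI[of _ u']) (auto simp: chi_def intro: order_trans)
    next
      case 3
      then obtain u' c' where "u' \<in> V1" "lab1 u' = u" "c' \<le> t * c"
        "walk_cost (tree_edges V1 r1 par1) (pull_weight w0 lab1) u' (chi1 v) c'"
        using T1 unfolding clan_tree_def by blast
      then show ?thesis using join(2) lab1 3(1) by (intro bexI[of _ u']) (auto simp: chi_def)
    qed
  qed
  have "clan_tree E w0 X w t (V1 \<union> V2) r1 lab par dep lev chi"
    unfolding clan_tree_def using join(1) img chi dist by blast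
  moreover have "N \<le> z" if "z \<in> V1 \<union> V2" for z using that N1 N2 by (fastforce simp: N'_def)
  moreover have "lab r1 = x" using r1 lab1 labelled_treeD(2)[OF LT1] by simp
  moreover have "\<exists>z\<in>V1 \<union> V2. lab z = p i \<and> dep z \<le> d (p i)" if "i \<le> m" for i
    using path[OF that]
  proof
    assume "\<exists>j\<le>m1. p i = p1 j"
    then obtain z where "z \<in> V1" "lab1 z = p i" "dep1 z \<le> d (p i)" using p1 by metis
    then show ?thesis by (intro bexI[of _ z]) (auto simp: lab_def dep_def)
  next
    assume "\<exists>j\<le>m2. p i = p2 j \<and> D0 + s + dA (p i) \<le> d (p i)"
    then obtain z where "z \<in> V2" "lab2 z = p i" "dep2 z \<le> dA (p i)" "D0 + s + dA (p i) \<le> d (p i)"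
      using p2 by metis
    then show ?thesis using depth'[of z] lab2 by (intro bexI[of _ z]) auto
  qed
  moreover have "(\<Sum>z\<in>V1 \<union> V2. mu (lab z)) \<le> B1 + B2"
    using B1 B2 disj labelled_treeD(1)[OF LT1] labelled_treeD(1)[OF LT2]
    by (simp add: sum.union_disjoint lab1 lab2)
  ultimately show ?thesis using dep unfolding rooted_clan_def by blast
qed

text \<open>The base of the recursion: at radius zero no petal can be cut. The cluster may still
  have many vertices, as weights may vanish; hop counts along zero-weight edges supply the strictly
  decreasing levels that distances cannot.\<close>

lemma rooted_clan_zero:
  assumes rd: "root_dist E X w x d" and tp: "tight_path E X w x d p m"
    and zero: "\<And>z. z \<in> X \<Longrightarrow> d z = 0" and w0: "\<And>e. e \<in> Restr E X \<Longrightarrow> w0 e \<le> 2 * w e"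
    and E: "sym E" "\<And>y z. (y, z) \<in> E \<Longrightarrow> w0 (y, z) = w0 (z, y)" and t: "0 \<le> t"
  shows "rooted_clan E w0 mu t N X w x d p m (\<Sum>v\<in>X. mu v)"
proof -
  define E0 where "E0 = {e \<in> Restr E X. w e = 0}"
  have reach: "(x, z) \<in> E0\<^sup>*" if "walk_cost (Restr E X) w x z c" "c \<le> 0" for z c
    using that
  proof (induction rule: walk_cost.induct)
    case (walk_step y c z)
    have "0 \<le> c" "0 \<le> w (y, z)"
      using walk_nonneg[OF walk_step(1) root_distD(6)[OF rd]] root_distD(6)[OF rd walk_step(2)] by auto
    then have "c \<le> 0" "w (y, z) = 0" using walk_step.prems by auto
    then show ?case using walk_step.IH walk_step.hyps(2) by (auto simp: E0_def intro: rtrancl_into_rtrancl)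
  qed simp
  define L where "L z = (LEAST n. (x, z) \<in> E0 ^^ n)" for z
  have "\<exists>y. (y, z) \<in> E0 \<and> L y < L z" if z: "z \<in> X" "z \<noteq> x" for z
  proof -
    have "(x, z) \<in> E0\<^sup>*" using reach[OF root_distD(4)[OF rd z(1)]] zero[OF z(1)] by simp
    then have L: "(x, z) \<in> E0 ^^ L z"
      unfolding L_def by (metis LeastI rtrancl_imp_relpow)
    then obtain n where n: "L z = Suc n" using z(2) by (cases "L z") auto
    then obtain y where y: "(x, y) \<in> E0 ^^ n" "(y, z) \<in> E0" using L by auto
    then have "L y \<le> n" unfolding L_def by (intro Least_le)
    then show ?thesis using n y by auto
  qed
  then obtain pr where pr: "\<And>z. z \<in> X \<Longrightarrow> z \<noteq> x \<Longrightarrow> (pr z, z) \<in> E0 \<and> L (pr z) < L z" by metis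
  obtain h n where h: "h ` X = {i. i < (n :: nat)}" "inj_on h X"
    using finite_imp_inj_to_nat_seg[OF root_distD(1)[OF rd]] by metis
  define h' where "h' v = N + h v" for v
  have inj: "inj_on h' X" using h(2) by (auto simp: inj_on_def h'_def)
  define lab where "lab = the_inv_into X h'"
  have lab: "lab (h' v) = v" if "v \<in> X" for v
    unfolding lab_def using the_inv_into_f_f[OF inj that] .
  define par where "par z = h' (pr (lab z))" for z
  have x: "x \<in> X" using root_distD(2)[OF rd] .
  have node: "par z \<in> h' ` X \<and> L (lab (par z)) < L (lab z) \<and> (lab (par z), lab z) \<in> E \<and>
      w0 (lab (par z), lab z) \<le> 2 * (0 - 0)" if z: "z \<in> h' ` X - {h' x}" for z
  proof -
    obtain v where v: "v \<in> X" "z = h' v" "v \<noteq> x" using z by auto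
    have e: "(pr v, v) \<in> Restr E X" "w (pr v, v) = 0" using pr[OF v(1,3)] by (auto simp: E0_def)
    then have "lab (par z) = pr v" using lab[of "pr v"] lab[OF v(1)] by (auto simp: par_def v(2))
    then show ?thesis using e w0[OF e(1)] pr[OF v(1,3)] lab[OF v(1)] by (auto simp: par_def v(2))
  qed
  have LT: "labelled_tree E w0 (h' ` X) (h' x) lab par (\<lambda>_. 0) (\<lambda>z. L (lab z))"
    using node root_distD(1)[OF rd] x by (simp add: labelled_tree_def)
  have "clan_tree E w0 X w t (h' ` X) (h' x) lab par (\<lambda>_. 0) (\<lambda>z. L (lab z)) h'"
    unfolding clan_tree_def
  proof (intro conjI ballI allI impI)
    show "lab ` h' ` X = X" using lab by (force simp: image_image)
    fix u v c assume u: "u \<in> X" and walk: "walk_cost (Restr E X) w u v c"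
    have v: "v \<in> X" using walk_in[OF walk u] .
    have "0 \<le> t * c" using t walk_nonneg[OF walk root_distD(6)[OF rd]] by simp
    moreover obtain c' where "c' \<le> 2 * (0 + 0)"
      "walk_cost (tree_edges (h' ` X) (h' x) par) (pull_weight w0 lab) (h' u) (h' v) c'"
      using tree_walk[OF LT E imageI[OF u] imageI[OF v]] by blast
    ultimately show "\<exists>u'\<in>h' ` X. lab u' = u \<and> (\<exists>c' \<le> t * c.
        walk_cost (tree_edges (h' ` X) (h' x) par) (pull_weight w0 lab) u' (h' v) c')"
      using u lab[OF u] by (intro bexI[of _ "h' u"] conjI exI[of _ c']) auto
  qed (use LT lab in auto)
  moreover have "\<exists>z\<in>h' ` X. lab z = p i \<and> 0 \<le> d (p i)" if "i \<le> m" for i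
    using tight_path_in[OF rd tp that] lab zero by (intro bexI[of _ "h' (p i)"]) auto
  moreover have "(\<Sum>z\<in>h' ` X. mu (lab z)) = (\<Sum>v\<in>X. mu v)"
    using lab by (simp add: sum.reindex[OF inj])
  ultimately show ?thesis
    unfolding rooted_clan_def using x lab zero
    by (intro exI[of _ "h' ` X"] exI[of _ "h' x"] exI[of _ lab] exI[of _ par] exI[of _ "\<lambda>_. 0"]
        exI[of _ "\<lambda>z. L (lab z)"] exI[of _ h']) (auto simp: h'_def)
qed

text \<open>If no \<open>j\<close> works, the logarithm of \<open>M / f j\<close> shrinks by the factor \<open>1 + \<kappa>\<close> in each step, from at
  most \<open>log 2 M\<close> to at least \<open>1\<close>; this is where the \<open>log log n\<close> of the distortion arises.\<close>
lemma slow_growth_step: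
  fixes f :: "nat \<Rightarrow> real"
  assumes f: "\<And>j. j \<le> L \<Longrightarrow> 1 \<le> f j" "f L \<le> M / 2" and \<kappa>: "0 < \<kappa>" and L: "log 2 M < (1 + \<kappa>) ^ L"
  shows "\<exists>j<L. f (Suc j) powr (1 + \<kappa>) \<le> f j * M powr \<kappa>"
proof (rule ccontr)
  assume neg: "\<not> ?thesis"
  have M: "2 \<le> M" using f(1)[of L] f(2) by simp
  define a where "a j = log 2 M - log 2 (f j)" for j
  have step: "(1 + \<kappa>) * a (Suc j) \<le> a j" if "j < L" for j
  proof -
    have fj: "1 \<le> f j" "1 \<le> f (Suc j)" using f(1)[of j] f(1)[of "Suc j"] that by auto
    have "f j * M powr \<kappa> \<le> f (Suc j) powr (1 + \<kappa>)" using neg that by (auto simp: not_le less_imp_le)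
    then have "log 2 (f j * M powr \<kappa>) \<le> log 2 (f (Suc j) powr (1 + \<kappa>))"
      using fj M by (subst log_le_cancel_iff) (auto intro!: mult_pos_pos)
    then have "log 2 (f j) + \<kappa> * log 2 M \<le> (1 + \<kappa>) * log 2 (f (Suc j))"
      using fj M by (simp add: log_mult log_powr)
    then show ?thesis by (simp add: a_def algebra_simps)
  qed
  have "(1 + \<kappa>) ^ j * a j \<le> a 0" if "j \<le> L" for j
    using that
  proof (induction j)
    case (Suc j)
    have "(1 + \<kappa>) ^ Suc j * a (Suc j) \<le> (1 + \<kappa>) ^ j * a j"
      using step[of j] Suc.prems \<kappa> by (simp add: mult.assoc mult.left_commute[of _ "1 + \<kappa>"] mult_left_mono)
    then show ?case using Suc by simp
  qed simp
  from this[of L] have "(1 + \<kappa>) ^ L * a L \<le> a 0" by simp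
  also have "a 0 \<le> log 2 M" using f(1)[of 0] by (simp add: a_def)
  finally have "(1 + \<kappa>) ^ L * a L < (1 + \<kappa>) ^ L * 1" using L by simp
  then have "a L < 1" using \<kappa> by (simp add: mult_less_cancel_left_pos)
  moreover have "log 2 (f L) \<le> log 2 (M / 2)" using f(1)[of L] f(2) by simp
  then have "1 \<le> a L" using M by (simp add: a_def log_divide)
  ultimately show False by simp
qed

text \<open>One of \<open>W L\<close> and its complement has at most half of the measure;
  \<open>slow_growth_step\<close> is applied on that side, outward or inward, hence
  \<open>2 * L\<close> layers. It charges the growing side at most
  \<open>f j * M powr \<kappa>\<close>; the other side has measure \<open>M - f j\<close> and costs
  at most \<open>(M - f j) * M powr \<kappa>\<close>. The two sets overlap in the layer between
  \<open>W j\<close> and \<open>W (Suc j)\<close>, the duplicated vertices.\<close>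

lemma region_growing:
  fixes W :: "nat \<Rightarrow> 'v set" and mu :: "'v \<Rightarrow> real"
  assumes X: "finite X" "\<And>v. v \<in> X \<Longrightarrow> 1 \<le> mu v"
    and W: "\<And>i j. i \<le> j \<Longrightarrow> W i \<subseteq> W j" "\<And>j. W j \<subseteq> X" "W 0 \<noteq> {}" "W (2 * L) \<noteq> X"
    and \<kappa>: "0 < \<kappa>" and L: "log 2 (sum mu X) < (1 + \<kappa>) ^ L"
  shows "\<exists>j < 2 * L. sum mu (W (Suc j)) powr (1 + \<kappa>) + sum mu (X - W j) powr (1 + \<kappa>)
    \<le> sum mu X powr (1 + \<kappa>)"
proof -
  define M where "M = sum mu X"
  have fin: "finite S" if "S \<subseteq> X" for S using X(1) that by (rule rev_finite_subset)
  have mono: "sum mu S \<le> sum mu S'" if "S \<subseteq> S'" "S' \<subseteq> X" for S S'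
  proof (rule sum_mono2[OF fin[OF that(2)] that(1)])
    show "0 \<le> mu v" if "v \<in> S' - S" for v using X(2)[of v] that \<open>S' \<subseteq> X\<close> by auto
  qed
  have ge1: "1 \<le> sum mu S" if "v \<in> S" "S \<subseteq> X" for v S
    using mono[of "{v}" S] X(2)[of v] that by auto
  have compl: "sum mu (X - S) = M - sum mu S" if "S \<subseteq> X" for S
    using X(1) that by (simp add: M_def sum_diff)
  have bound: "s powr (1 + \<kappa>) \<le> s * M powr \<kappa>" if "0 \<le> s" "s \<le> M" for s
    using that \<kappa> by (cases "s = 0") (auto simp: powr_add powr_mono2 mult_left_mono)
  have total: "M * M powr \<kappa> = M powr (1 + \<kappa>)"
    using mono[of "{}" X] by (cases "M = 0") (auto simp: M_def powr_add)
  have pos: "0 \<le> sum mu S" "sum mu S \<le> M" if "S \<subseteq> X" for S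
    using mono[of "{}" S] mono[of S X] that by (auto simp: M_def)
  show ?thesis
  proof (cases "sum mu (W L) \<le> M / 2")
    case True
    obtain v where v: "v \<in> W 0" using W(3) by auto
    have "\<exists>j<L. sum mu (W (Suc j)) powr (1 + \<kappa>) \<le> sum mu (W j) * M powr \<kappa>"
    proof (rule slow_growth_step[where f = "\<lambda>j. sum mu (W j)", OF _ True \<kappa> L[folded M_def]])
      show "1 \<le> sum mu (W j)" for j using ge1[of v "W j"] v W(1)[of 0 j] W(2)[of j] by auto
    qed
    then obtain j where j: "j < L" "sum mu (W (Suc j)) powr (1 + \<kappa>) \<le> sum mu (W j) * M powr \<kappa>" by auto
    have "sum mu (X - W j) powr (1 + \<kappa>) \<le> (M - sum mu (W j)) * M powr \<kappa>"
      using bound[OF pos[of "X - W j"]] compl[OF W(2)] by auto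
    then have "sum mu (W (Suc j)) powr (1 + \<kappa>) + sum mu (X - W j) powr (1 + \<kappa>) \<le> M * M powr \<kappa>"
      using j(2) by (simp add: algebra_simps)
    then show ?thesis using j(1) total by (intro exI[of _ j]) (simp add: M_def)
  next
    case False
    obtain v where v: "v \<in> X - W (2 * L)" using W(2,4) by auto
    \<comment> \<open>Inward growth: complements with reversed indices, so that step
      \<open>j\<close> corresponds to the layer \<open>i = 2 * L - Suc j\<close>.\<close>
    define f where "f j = sum mu (X - W (2 * L - j))" for j
    have "\<exists>j<L. f (Suc j) powr (1 + \<kappa>) \<le> f j * M powr \<kappa>"
    proof (rule slow_growth_step[where f = f, OF _ _ \<kappa> L[folded M_def]])
      show "1 \<le> f j" for j
        unfolding f_def using ge1[of v "X - W (2 * L - j)"] v W(1)[of "2 * L - j" "2 * L"] by auto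
      show "f L \<le> M / 2" using False compl[OF W(2)[of L]] by (simp add: f_def)
    qed
    then obtain j where j: "j < L" "f (Suc j) powr (1 + \<kappa>) \<le> f j * M powr \<kappa>" by auto
    define i where "i = 2 * L - Suc j"
    have i: "i < 2 * L" "f (Suc j) = sum mu (X - W i)" "f j = sum mu (X - W (Suc i))"
      using j(1) by (auto simp: f_def i_def Suc_diff_Suc)
    have "sum mu (W (Suc i)) powr (1 + \<kappa>) \<le> sum mu (W (Suc i)) * M powr \<kappa>"
      using bound[OF pos[OF W(2)]] .
    moreover have "sum mu (X - W i) powr (1 + \<kappa>) \<le> (M - sum mu (W (Suc i))) * M powr \<kappa>"
      using j(2) i(2,3) compl[OF W(2)[of "Suc i"]] by simp
    ultimately have "sum mu (W (Suc i)) powr (1 + \<kappa>) + sum mu (X - W i) powr (1 + \<kappa>) \<le> M * M powr \<kappa>"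
      by (simp add: algebra_simps)
    then show ?thesis using i(1) total by (intro exI[of _ i]) (simp add: M_def)
  qed
qed

section \<open>Recursive petal cuts\<close>

text \<open>By \<open>g_lipschitz\<close> the gain along the walk stays within \<open>2 * c\<close>
  of \<open>g v\<close>, which is less than half of \<open>b - a\<close>. Starting at or above the
  midpoint it cannot drop below \<open>a\<close>; starting below it cannot reach
  \<open>b\<close>.\<close>

lemma (in petal_cut) walk_separated:
  assumes u: "u \<in> X" and walk: "walk_cost (Restr E X) w u v c" and c: "4 * c < b - a"
  shows "if (a + b) / 2 \<le> g v then u \<in> A \<and> walk_cost (Restr E A) w u v c
    else u \<in> {z \<in> X. g z < b} \<and> walk_cost (Restr E {z \<in> X. g z < b}) w u v c"
proof -
  have v: "v \<in> X" and c0: "0 \<le> c" using walk_in[OF walk u] walk_nonneg[OF walk w_nonneg] by auto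
  note near = walk_near[OF walk w_nonneg g_lipschitz]
  show ?thesis
  proof (cases "(a + b) / 2 \<le> g v")
    case True
    have "walk_cost (Restr E A) w u v c"
    proof (rule near)
      fix z assume "z \<in> X" "\<bar>g z - g v\<bar> \<le> 2 * c"
      then show "z \<in> A" using True c by (simp add: field_simps abs_le_iff)
    qed
    moreover have "v \<in> A" using True c c0 v by (simp add: field_simps)
    ultimately show ?thesis using True walk_in_rev by metis
  next
    case False
    have "walk_cost (Restr E {z \<in> X. g z < b}) w u v c"
    proof (rule near)
      fix z assume "z \<in> X" "\<bar>g z - g v\<bar> \<le> 2 * c"
      then show "z \<in> {z \<in> X. g z < b}" using False c by (simp add: field_simps abs_le_iff)
    qed
    moreover have "v \<in> {z \<in> X. g z < b}" using False c c0 v by (simp add: field_simps)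
    ultimately show ?thesis using False walk_in_rev by metis
  qed
qed

text \<open>The path \<open>p\<close> carries all edges whose weight was reduced, and no edge may be halved twice. If
  \<open>p\<close> reaches far, the petal is cut around its own end and nothing is halved: the path up to the
  petal is preserved exactly, and being at least half as long as \<open>p\<close> it pays for the detour. If
  \<open>p\<close> is short, a petal around the farthest vertex avoids \<open>p\<close>, and the path into it is halved.\<close>
lemma rooted_clan_exists:
  assumes E: "sym E" and w0_sym: "\<And>y z. (y, z) \<in> E \<Longrightarrow> w0 (y, z) = w0 (z, y)" and \<kappa>: "0 < \<kappa>"
    and "root_dist E X w x d" "tight_path E X w x d p m" "\<And>y z. (y, z) \<in> E \<Longrightarrow> w (y, z) = w (z, y)"
    and "\<And>e. e \<in> Restr E X \<Longrightarrow> w0 e \<le> 2 * w e"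
    and "\<And>e. e \<in> Restr E X \<Longrightarrow> e \<notin> path_edges p m \<Longrightarrow> w e = w0 e"
    and "\<And>v. v \<in> X \<Longrightarrow> 1 \<le> mu v" and "log 2 (sum mu X) < (1 + \<kappa>) ^ L"
  shows "rooted_clan E w0 mu (512 * real L) N X w x d p m (sum mu X powr (1 + \<kappa>))"
  using assms(4-)
proof (induction "card X" arbitrary: X w x d p m N rule: less_induct)
  case less
  note rd = less.prems(1) and p_path = less.prems(2) and w_sym = less.prems(3) and half = less.prems(4)
    and unhalved = less.prems(5) and mu = less.prems(6) and L = less.prems(7)
  have fin: "finite X" and x: "x \<in> X" and dx: "d x = 0" using root_distD(1-3)[OF rd] .
  have mono: "sum mu S \<le> sum mu X" if "S \<subseteq> X" for S
  proof (rule sum_mono2[OF fin that])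
    show "0 \<le> mu v" if "v \<in> X - S" for v using mu[of v] that by auto
  qed
  have ge1: "1 \<le> sum mu S" if "v \<in> S" "S \<subseteq> X" for v S
  proof -
    have "mu v \<le> sum mu S"
      by (rule member_le_sum[OF that(1)]) (use that mu fin finite_subset[OF that(2)] in force)+
    then show ?thesis using mu[of v] that by auto
  qed
  show ?case
  proof (cases "\<forall>z\<in>X. d z = 0")
    case True
    have "sum mu X powr 1 \<le> sum mu X powr (1 + \<kappa>)"
      using ge1[OF x] \<kappa> by (intro powr_mono) auto
    then have "sum mu X \<le> sum mu X powr (1 + \<kappa>)" using ge1[OF x] by simp
    moreover have "rooted_clan E w0 mu (512 * real L) N X w x d p m (sum mu X)"
      using True half E w0_sym by (intro rooted_clan_zero[OF rd p_path]) auto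
    ultimately show ?thesis by (rule rooted_clan_mono[rotated])
  next
    case False
    define z0 where "z0 = arg_min_on (\<lambda>z. - d z) X"
    have z0: "z0 \<in> X" "\<And>z. z \<in> X \<Longrightarrow> d z \<le> d z0"
      using arg_min_if_finite[of X "\<lambda>z. - d z"] fin x unfolding z0_def by (auto simp: not_less)
    obtain z where "z \<in> X" "d z \<noteq> 0" using False by auto
    then have dz0: "0 < d z0" using z0(2)[of z] root_dist_nonneg[OF rd, of z] by auto
    define long where "long \<longleftrightarrow> d z0 / 2 \<le> d (p m)"
    obtain q n where tq: "tight_path E X w x d q n" and long: "long \<Longrightarrow> q = p \<and> n = m"
      and short: "\<not> long \<Longrightarrow> q n = z0"
    proof (cases long)
      case True
      then show thesis using that p_path by simp
    next
      case False
      obtain q n where "tight_path E X w x d q n" "q n = z0" using tight_path_exists[OF rd z0(1)] .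
      then show thesis using that False by simp
    qed
    define D where "D = d (q n)"
    have D: "d z0 / 2 \<le> D" "0 < D"
      using long short dz0 by (cases long; simp add: D_def long_def)+
    obtain d' where rd': "root_dist E X (halve q n w) x d'"
      by (rule root_dist_cheaper[OF rd, of "halve q n w"]) (use root_distD(6)[OF rd] in \<open>auto simp: halve_def\<close>)
    interpret petal E X w x d q n d'
      using E w_sym rd tq rd' by unfold_locales
    \<comment> \<open>\<open>2 * L\<close> steps of length \<open>h\<close> lead from
      \<open>D / 2\<close>, the gain at the end of \<open>q\<close>, down to \<open>D / 4\<close>.
      This lower limit pays for the detour into the petal if \<open>p\<close> is long, and keeps the
      petal off \<open>p\<close> if \<open>p\<close> is short.\<close>
    define h where "h = D / (8 * real L)"
    define \<theta> where "\<theta> j = D / 2 - real j * h" for j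
    define W where "W j = {z \<in> X. \<theta> j \<le> g z}" for j
    have h0: "0 \<le> h" using D by (simp add: h_def)
    have \<theta>: "D / 4 \<le> \<theta> j" if "j \<le> 2 * L" for j
    proof -
      have "real j * h \<le> real (2 * L) * h" using that h0 by (intro mult_right_mono) auto
      also have "\<dots> \<le> D / 4" using D by (simp add: h_def)
      finally show ?thesis by (simp add: \<theta>_def)
    qed
    have gx: "g x = 0" using dx root_distD(3)[OF rd'] by (simp add: g_def)
    have gq: "g (q n) = D / 2" using g_q[of n] by (simp add: D_def)
    have "\<exists>j < 2 * L. sum mu (W (Suc j)) powr (1 + \<kappa>) + sum mu (X - W j) powr (1 + \<kappa>)
      \<le> sum mu X powr (1 + \<kappa>)"
    proof (rule region_growing[OF fin mu _ _ _ _ \<kappa> L])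
      fix i j :: nat assume "i \<le> j"
      then have "real i * h \<le> real j * h" using h0 by (intro mult_right_mono) auto
      then show "W i \<subseteq> W j" by (auto simp: W_def \<theta>_def)
    next
      show "W j \<subseteq> X" for j by (auto simp: W_def)
      have "q n \<in> W 0" using q_in[of n] gq by (simp add: W_def \<theta>_def)
      then show "W 0 \<noteq> {}" by auto
      have "x \<notin> W (2 * L)" using gx \<theta>[of "2 * L"] D by (auto simp: W_def)
      then show "W (2 * L) \<noteq> X" using x by auto
    qed
    then obtain j where j: "j < 2 * L" and cost: "sum mu (W (Suc j)) powr (1 + \<kappa>) +
        sum mu (X - W j) powr (1 + \<kappa>) \<le> sum mu X powr (1 + \<kappa>)" by auto
    have L0: "0 < real L" and h_pos: "0 < h" using j D by (auto simp: h_def)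
    define a where "a = \<theta> (Suc j)"
    define b where "b = \<theta> j"
    have ab: "b - a = h" "D / 4 \<le> a" "b \<le> D / 2" "0 < a" "a < b"
      using \<theta>[of "Suc j"] j h_pos D by (auto simp: a_def b_def \<theta>_def algebra_simps)
    define i1 where "i1 = (LEAST i. a \<le> g (q i))"
    have an: "a \<le> g (q n)" using ab gq by simp
    interpret petal_cut E X w x d q n d' a i1
    proof
      show "i1 \<le> n" using an unfolding i1_def by (rule Least_le)
      show "a \<le> g (q i1)" using an unfolding i1_def by (rule LeastI)
      show "g (q i) < a" if "i < i1" for i using not_less_Least[OF that[unfolded i1_def]] by simp
    qed (rule ab(4))
    define Y where "Y = {z \<in> X. g z < b}"
    have WA: "W (Suc j) = A" and WY: "X - W j = Y" by (auto simp: W_def Y_def a_def b_def)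
    have AX: "A \<subseteq> X" and YX: "Y \<subseteq> X" by (auto simp: Y_def)
    have xA: "x \<notin> A" and xY: "x \<in> Y" using gx ab x by (auto simp: Y_def)
    have qY: "q n \<notin> Y" using gq ab by (auto simp: Y_def)
    have cardA: "card A < card X" using AX x xA fin by (metis psubsetI psubset_card_mono)
    have cardY: "card Y < card X" using YX q_in[of n] qY fin by (metis order_refl psubsetI psubset_card_mono)
    define x1 where "x1 = q i1"
    define y1 where "y1 = q (i1 - 1)"
    have edge: "(y1, x1) \<in> Restr E X" "d x1 = d y1 + w (y1, x1)"
      using q_edge[of "i1 - 1"] q_step[of "i1 - 1"] i1(1) i1_pos by (auto simp: x1_def y1_def)
    have x1: "x1 \<in> A" "2 * a \<le> d x1" "d' x1 = d x1 / 2"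
      using i1(1,2) q_in[of i1] g_q[of i1] d'_q[of i1] by (auto simp: x1_def)
    have "g y1 < a" "g y1 = d y1 / 2"
      using i1(3)[of "i1 - 1"] i1(1) i1_pos g_q[of "i1 - 1"] by (auto simp: y1_def)
    then have y1: "y1 \<in> Y" "d y1 < 2 * a" using ab edge(1) by (auto simp: Y_def)
    have logY: "log 2 (sum mu Y) < (1 + \<kappa>) ^ L"
      using mono[OF YX] ge1[OF xY YX] L by (smt (verit) log_le_cancel_iff)
    have logA: "log 2 (sum mu A) < (1 + \<kappa>) ^ L"
      using mono[OF AX] ge1[OF x1(1) AX] L by (smt (verit) log_le_cancel_iff)
    have rdY: "root_dist E Y w x d" unfolding Y_def using ab by (intro below_root_dist) simp
    \<comment> \<open>Stated for any prefix that carries all edges of \<open>p\<close> inside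
      \<open>Y\<close>, since the two cases keep different ones: the part before \<open>p\<close>
      leaves \<open>Y\<close> if \<open>p\<close> is long, all of \<open>p\<close>
      otherwise.\<close>
    have IHY: "rooted_clan E w0 mu (512 * real L) N Y w x d p m1 (sum mu Y powr (1 + \<kappa>))"
      if "m1 \<le> m" "\<And>i. i \<le> m1 \<Longrightarrow> p i \<in> Y" "\<And>e. e \<in> Restr E Y \<Longrightarrow> e \<in> path_edges p m \<Longrightarrow> e \<in> path_edges p m1"
      for m1 N
    proof (rule less.hyps[OF cardY rdY tight_path_prefix[OF p_path that(1,2)] w_sym])
      show "w e = w0 e" if "e \<in> Restr E Y" "e \<notin> path_edges p m1" for e
        using unhalved[of e] that \<open>\<And>e. e \<in> Restr E Y \<Longrightarrow> e \<in> path_edges p m \<Longrightarrow> e \<in> path_edges p m1\<close> YX by blast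
    qed (use half mu YX logY in auto)
    have "rooted_clan E w0 mu (512 * real L) N X w x d p m
      (sum mu Y powr (1 + \<kappa>) + sum mu A powr (1 + \<kappa>))"
    proof -
      have X: "X = Y \<union> A" using ab by (auto simp: Y_def)
      have C1: "v \<in> A" if "v \<in> X" "(a + b) / 2 \<le> g v" for v using that ab by auto
      have C2: "v \<in> Y" if "v \<in> X" "\<not> (a + b) / 2 \<le> g v" for v using that ab by (auto simp: Y_def)
      \<comment> \<open>Root distances are at most \<open>2 * D\<close>, so \<open>16 * D\<close>
        bounds tree distances, while a walk that may be cut costs at least
        \<open>h / 4 = D / (32 * real L)\<close>. The quotient is
        \<open>512 * real L\<close>.\<close>
      have R: "8 * d z \<le> 16 * D" if "z \<in> X" for z using z0(2)[OF that] D(1) by simp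
      have sep: "16 * D \<le> 512 * real L * c \<or> (if (a + b) / 2 \<le> g v
          then u \<in> A \<and> walk_cost (Restr E A) w u v c else u \<in> Y \<and> walk_cost (Restr E Y) w u v c)"
        if "u \<in> X" "walk_cost (Restr E X) w u v c" for u v c
      proof (cases "4 * c < b - a")
        case True
        then show ?thesis using walk_separated[OF that] unfolding Y_def by blast
      next
        case False
        then have "D / (32 * real L) \<le> c" using ab(1) by (simp add: h_def)
        then have "16 * D \<le> 512 * real L * c" using L0 by (simp add: field_simps)
        then show ?thesis by blast
      qed
      have join: ?thesis
        if "\<And>N. rooted_clan E w0 mu (512 * real L) N Y w x d p m1 (sum mu Y powr (1 + \<kappa>))"
          "\<And>N. rooted_clan E w0 mu (512 * real L) N A wA x1 dA q2 m2 (sum mu A powr (1 + \<kappa>))"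
          "w0 (y1, x1) \<le> 2 * s"
          "y1 \<in> Y \<and> D0 = 2 * d y1 \<or> (\<exists>i\<le>m1. y1 = p i \<and> D0 = d y1)"
          "\<And>z. z \<in> A \<Longrightarrow> D0 + s + 2 * dA z \<le> 2 * d z"
          "\<And>i. i \<le> m \<Longrightarrow> (\<exists>k\<le>m1. p i = p k) \<or> (\<exists>k\<le>m2. p i = q2 k \<and> D0 + s + dA (p i) \<le> d (p i))"
          "\<And>e. e \<in> Restr E A \<Longrightarrow> wA e \<le> w e"
        for m1 wA dA q2 m2 s D0
        apply (rule rooted_clan_join[where E = E and ?w0.0 = w0 and Y = Y and w = w and d = d and ?p1.0 = p
              and ?m1.0 = m1 and A = A and wA = wA and dA = dA and ?p2.0 = q2 and ?m2.0 = m2 and X = X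
              and ?x1.0 = x1 and ?y1.0 = y1 and s = s and ?D0.0 = D0 and R = "16 * D"
              and p = p and m = m and C = "\<lambda>v. (a + b) / 2 \<le> g v"])
        subgoal by (rule that(1))
        subgoal by (rule that(2))
        subgoal by (rule E)
        subgoal by (rule w0_sym)
        subgoal by (rule X)
        subgoal using edge by auto
        subgoal by (rule that(3))
        subgoal by (rule that(4))
        subgoal by (rule that(5))
        subgoal by (rule that(6))
        subgoal by (rule that(7))
        subgoal by simp
        subgoal by (rule C1)
        subgoal by (rule C2)
        subgoal by (rule R)
        subgoal by (rule sep)
        done
      show ?thesis
      proof (cases long)
        case True
        then have qp: "q = p" "n = m" using long by auto
        \<comment> \<open>\<open>p\<close> is split at both thresholds: the prefix before
          \<open>i2\<close> is preserved in \<open>Y\<close>, the suffix from \<open>i1\<close> in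
          the petal. As \<open>i1 \<le> i2\<close>, they cover \<open>p\<close>, and
          \<open>y1\<close> lies on the prefix; \<open>0 < i1\<close> makes the subtractions of 1
          genuine.\<close>
        define i2 where "i2 = (LEAST i. b \<le> g (p i))"
        have bm: "b \<le> g (p m)" using gq ab qp by simp
        have i2: "i2 \<le> m" "b \<le> g (p i2)" using bm unfolding i2_def by (rule Least_le, rule LeastI)
        have below: "p i \<in> Y" if "i < i2" for i
          using not_less_Least[OF that[unfolded i2_def]] q_in[of i] that i2(1) qp by (auto simp: Y_def)
        have i12: "i1 \<le> i2" using i1(3)[of i2] i2 ab qp by (force simp: not_less[symmetric])
        have above: "p i \<notin> Y" if "i2 \<le> i" "i \<le> m" for i
          using d_mono[of i2 i] g_q[of i] g_q[of i2] i2 that qp by (auto simp: Y_def)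
        have "rooted_clan E w0 mu (512 * real L) N Y w x d p (i2 - 1) (sum mu Y powr (1 + \<kappa>))" for N
        proof (rule IHY)
          show "p i \<in> Y" if "i \<le> i2 - 1" for i using that i12 i1_pos by (intro below) auto
          show "e \<in> path_edges p (i2 - 1)" if e: "e \<in> Restr E Y" "e \<in> path_edges p m" for e
          proof -
            obtain i where i: "i < m" "e = (p i, p (Suc i)) \<or> e = (p (Suc i), p i)"
              using e(2) by (auto simp: path_edges_def)
            then have "p (Suc i) \<in> Y" using e(1) by auto
            then have "Suc i < i2" using above[of "Suc i"] i(1) by (auto simp: not_less[symmetric])
            then have "i < i2 - 1" by simp
            then show ?thesis using i(2) unfolding path_edges_def by blast
          qed
        qed (use i2 in simp)
        note clanY = this
        obtain dA where dA: "root_dist E A w x1 dA"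
          "\<And>z. z \<in> A \<Longrightarrow> dA z \<le> d' z + d (q n) / 2 - d x1"
          "\<And>i. i1 \<le> i \<Longrightarrow> i \<le> n \<Longrightarrow> dA (q i) = d (q i) - d x1"
          using root_dist_petal unfolding x1_def by blast
        have tA: "tight_path E A w x1 dA (\<lambda>i. q (i + i1)) (n - i1)"
          using tight_path_petal dA(3) unfolding x1_def by blast
        have "rooted_clan E w0 mu (512 * real L) N A w x1 dA (\<lambda>i. q (i + i1)) (n - i1)
            (sum mu A powr (1 + \<kappa>))" for N
        proof (rule less.hyps[OF cardA dA(1) tA w_sym])
          show "w e = w0 e" if "e \<in> Restr E A" "e \<notin> path_edges (\<lambda>i. q (i + i1)) (n - i1)" for e
            using unhalved[of e] that path_shift_edges[of e] qp by auto
        qed (use half mu logA in auto)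
        from clanY this show ?thesis
        proof (rule join[where s = "d x1 - d y1" and ?D0.0 = "d y1"])
          show "w0 (y1, x1) \<le> 2 * (d x1 - d y1)" using edge half[of "(y1, x1)"] by simp
          show "y1 \<in> Y \<and> d y1 = 2 * d y1 \<or> (\<exists>i\<le>i2 - 1. y1 = p i \<and> d y1 = d y1)"
            using i12 qp by (intro disjI2 exI[of _ "i1 - 1"]) (auto simp: y1_def)
          \<comment> \<open>The left side is at most \<open>2 * d z - 2 * g z + D - d x1\<close>.
            Since \<open>a \<le> g z\<close> and \<open>2 * a \<le> d x1\<close>, the bound
            \<open>D / 4 \<le> a\<close> cancels the detour.\<close>
          show "d y1 + (d x1 - d y1) + 2 * dA z \<le> 2 * d z" if "z \<in> A" for z
            using dA(2)[OF that] x1(2) ab(2) that by (simp add: D_def g_def)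
          show "(\<exists>k\<le>i2 - 1. p i = p k) \<or>
              (\<exists>k\<le>n - i1. p i = q (k + i1) \<and> d y1 + (d x1 - d y1) + dA (p i) \<le> d (p i))"
            if "i \<le> m" for i
          proof (cases "i \<le> i2 - 1")
            case True
            then show ?thesis by auto
          next
            case False
            then have "i1 \<le> i" using i12 by simp
            then show ?thesis using dA(3)[of i] that qp by (intro disjI2 exI[of _ "i - i1"]) auto
          qed
        qed simp
      next
        case False
        then have qz: "q n = z0" using short by simp
        have pA: "p i \<notin> A" "p i \<in> Y" if "i \<le> m" for i
        proof -
          have pX: "p i \<in> X" using tight_path_in[OF rd p_path that] .
          have "d (p i) \<le> d (p m)"
            using tight_path_mono[OF rd p_path that order_refl] .
          then have "g (p i) < D / 4"
            using g_le[OF pX] False qz by (simp add: long_def D_def)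
          then show "p i \<notin> A" "p i \<in> Y" using ab pX by (auto simp: Y_def)
        qed
        \<comment> \<open>Edges touching the petal avoid \<open>p\<close>, so none of them has been
          reduced before and all may be halved now.\<close>
        have offA: "e \<notin> path_edges p m" if "fst e \<in> A \<or> snd e \<in> A" for e
        proof
          assume "e \<in> path_edges p m"
          then obtain i where "i < m" "e = (p i, p (Suc i)) \<or> e = (p (Suc i), p i)"
            by (auto simp: path_edges_def)
          then show False using that pA(1)[of i] pA(1)[of "Suc i"] by auto
        qed
        have "rooted_clan E w0 mu (512 * real L) N Y w x d p m (sum mu Y powr (1 + \<kappa>))" for N
          using pA(2) by (intro IHY) auto
        note clanY = this
        define wA where "wA = halve q n w"
        define dA where "dA z = d' z - d' x1" for z
        have rdA: "root_dist E A wA x1 dA" and tA: "tight_path E A wA x1 dA (\<lambda>i. q (i + i1)) (n - i1)"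
          using root_dist_halved tight_path_halved unfolding wA_def dA_def[abs_def] x1_def by auto
        have w0A: "w e = w0 e" "0 \<le> w e" if "e \<in> Restr E A" for e
          using unhalved[of e] offA[of e] that w_nonneg[of e] by auto
        have "rooted_clan E w0 mu (512 * real L) N A wA x1 dA (\<lambda>i. q (i + i1)) (n - i1)
            (sum mu A powr (1 + \<kappa>))" for N
        proof (rule less.hyps[OF cardA rdA tA])
          show "wA (y, z) = wA (z, y)" if "(y, z) \<in> E" for y z using halve_sym[OF that] by (simp add: wA_def)
          show "w0 e \<le> 2 * wA e" if "e \<in> Restr E A" for e using w0A[OF that] by (simp add: wA_def halve_def)
          show "wA e = w0 e" if "e \<in> Restr E A" "e \<notin> path_edges (\<lambda>i. q (i + i1)) (n - i1)" for e
            using path_shift_edges[of e] that w0A[of e] by (auto simp: wA_def halve_def)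
        qed (use mu logA in auto)
        from clanY this show ?thesis
        \<comment> \<open>The connecting edge crosses distance \<open>2 * a\<close> from the root.
          Its part before that counts in full, the rest half:
          \<open>s = (2 * a - d y1) + (d x1 - 2 * a) / 2\<close>. With
          \<open>d y1 < 2 * a \<le> d x1\<close> this covers half of the edge and still meets the
          depth bound.\<close>
        proof (rule join[where s = "d x1 / 2 + a - d y1" and ?D0.0 = "2 * d y1"])
          have "w (y1, x1) = w0 (y1, x1)" using unhalved[OF edge(1) offA] x1(1) by simp
          then show "w0 (y1, x1) \<le> 2 * (d x1 / 2 + a - d y1)" using edge(2) y1(2) by (simp add: field_simps)
          show "y1 \<in> Y \<and> 2 * d y1 = 2 * d y1 \<or> (\<exists>i\<le>m. y1 = p i \<and> 2 * d y1 = d y1)" using y1 by simp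
          show "2 * d y1 + (d x1 / 2 + a - d y1) + 2 * dA z \<le> 2 * d z" if "z \<in> A" for z
            using that x1 y1 by (simp add: dA_def g_def)
          show "wA e \<le> w e" if "e \<in> Restr E A" for e using w0A[OF that] by (simp add: wA_def halve_def)
        qed auto
      qed
    qed
    then show ?thesis by (rule rooted_clan_mono) (use cost in \<open>simp add: WA WY\<close>)
  qed
qed

section \<open>Spanning clan embeddings\<close>

context pair_wf_digraph
begin

lemma awalk_walk_cost: "awalk u p v \<Longrightarrow> walk_cost (parcs G) w u v (awalk_cost w p)"
proof (induction p arbitrary: u)
  case (Cons e p)
  then have "awalk (snd e) p v" "fst e = u" "e \<in> parcs G" by (auto simp: awalk_Cons_iff)
  then have "walk_cost (parcs G) w u (snd e) (w e)" using walk_edge[of u "snd e" "parcs G" w] by auto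
  from walk_trans[OF Cons.IH[OF \<open>awalk (snd e) p v\<close>] this] show ?case by simp
qed (auto simp: awalk_Nil_iff intro: walk_refl)

lemma walk_cost_awalk:
  assumes "walk_cost (parcs G) w u v c" "u \<in> pverts G"
  shows "\<exists>p. awalk u p v \<and> awalk_cost w p = c"
  using assms
proof (induction rule: walk_cost.induct)
  case walk_refl
  then show ?case by (intro exI[of _ "[]"]) (simp add: awalk_Nil_iff)
next
  case (walk_step y c z)
  then obtain p where p: "awalk u p y" "awalk_cost w p = c" by auto
  have "awalk y [(y, z)] z"
    using walk_step(2) wellformed' by (auto simp: awalk_def)
  from awalk_appendI[OF p(1) this] p(2) show ?case by (intro exI[of _ "p @ [(y, z)]"]) simp
qed

lemma sp_dist_le_walk:
  assumes "walk_cost (parcs G) w u v c" "u \<in> pverts G"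
  shows "sp_dist G w u v \<le> ereal c"
  using walk_cost_awalk[OF assms] min_cost_le_walk_cost by auto

lemma le_sp_dist:
  assumes "\<And>c. walk_cost (parcs G) w u v c \<Longrightarrow> b \<le> ereal c"
  shows "b \<le> sp_dist G w u v"
  unfolding \<mu>_def using assms[OF awalk_walk_cost] by (intro INF_greatest) auto

lemma Restr_parcs: "Restr (parcs G) (pverts G) = parcs G"
  using wellformed' by auto

end

lemma weighted_graphD:
  assumes "weighted_graph G w"
  shows "pair_graph G" "pverts G \<noteq> {}" "finite (pverts G)" "sym (parcs G)"
    "(y, z) \<in> parcs G \<Longrightarrow> w (y, z) = w (z, y)" "e \<in> parcs G \<Longrightarrow> 0 \<le> w e"
    "u \<in> pverts G \<Longrightarrow> v \<in> pverts G \<Longrightarrow>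
      \<exists>c\<ge>0. walk_cost (parcs G) w u v c \<and> sp_dist G w u v = ereal c"
proof -
  show pg: "pair_graph G" using assms by (simp add: weighted_graph_def)
  interpret pair_graph G by fact
  have sc: "strongly_connected (with_proj G)"
    using assms pair_sym_arcs by (intro symmetric_connected_imp_strongly_connected) (auto simp: weighted_graph_def)
  show "pverts G \<noteq> {}" using sc by (auto simp: strongly_connected_def)
  show "finite (pverts G)" by (rule pair_finite_verts)
  show "sym (parcs G)" using arcs_symmetric by (auto intro: symI)
  show "w (y, z) = w (z, y)" if "(y, z) \<in> parcs G" using assms that by (auto simp: weighted_graph_def)
  show nonneg: "0 \<le> w e" if "e \<in> parcs G" for e using assms that by (auto simp: weighted_graph_def)
  show "\<exists>c\<ge>0. walk_cost (parcs G) w u v c \<and> sp_dist G w u v = ereal c"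
    if "u \<in> pverts G" "v \<in> pverts G"
  proof -
    have "u \<rightarrow>\<^sup>*\<^bsub>with_proj G\<^esub> v" using sc that by (auto simp: strongly_connected_def)
    from min_cost_awalk[where c = w, OF this nonneg] obtain p where
      p: "awalk u p v" "sp_dist G w u v = ereal (awalk_cost w p)" by (auto simp: apath_def)
    have walk: "walk_cost (parcs G) w u v (awalk_cost w p)" by (rule awalk_walk_cost[OF p(1)])
    show ?thesis using walk_nonneg[OF walk nonneg] walk p(2) by auto
  qed
qed

section \<open>Trees as host graphs\<close>

definition host_tree :: "nat set \<Rightarrow> nat \<Rightarrow> (nat \<Rightarrow> nat) \<Rightarrow> nat pair_pre_digraph" where
  "host_tree V r par = \<lparr>pverts = V, parcs = tree_edges V r par\<rparr>"

lemma host_tree_simps [simp]: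
  "pverts (host_tree V r par) = V" "parcs (host_tree V r par) = tree_edges V r par"
  by (simp_all add: host_tree_def)

lemma host_pair_graph:
  assumes T: "labelled_tree E w V r lab par dep lev"
  shows "pair_graph (host_tree V r par)"
proof
  show "fst e \<in> pverts (host_tree V r par)" "snd e \<in> pverts (host_tree V r par)"
    if "e \<in> parcs (host_tree V r par)" for e
    using tree_edges_nodes[OF T] that by auto
  show "finite (pverts (host_tree V r par))" using labelled_treeD(1)[OF T] by simp
  show "finite (parcs (host_tree V r par))"
  proof (rule finite_subset)
    show "parcs (host_tree V r par) \<subseteq> V \<times> V" using tree_edges_nodes[OF T] by force
  qed (use labelled_treeD(1)[OF T] in simp)
  show "symmetric (with_proj (host_tree V r par))"
    using tree_edges_sym by (simp add: symmetric_def)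
  show "fst e \<noteq> snd e" if e: "e \<in> parcs (host_tree V r par)" for e
  proof -
    obtain z where "z \<in> V" "z \<noteq> r" "e = (z, par z) \<or> e = (par z, z)"
      using e by (auto simp: tree_edges_def)
    then show ?thesis using labelled_treeD(5)[OF T, of z] by auto
  qed
qed

lemma host_connected:
  assumes T: "labelled_tree E w V r lab par dep lev" and E: "sym E" "\<And>y z. (y, z) \<in> E \<Longrightarrow> w (y, z) = w (z, y)"
  shows "Digraph_Component.connected (with_proj (host_tree V r par))"
proof -
  interpret pair_graph "host_tree V r par" using host_pair_graph[OF T] .
  show ?thesis
  proof (rule connectedI)
    show "pverts (host_tree V r par) \<noteq> {}" using labelled_treeD(2)[OF T] by auto
    fix u v assume "u \<in> pverts (host_tree V r par)" "v \<in> pverts (host_tree V r par)"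
    then obtain c where "walk_cost (tree_edges V r par) (pull_weight w lab) u v c" "u \<in> V"
      using tree_walk[OF T E, of u v] by auto
    then obtain p where "awalk u p v" using walk_cost_awalk by fastforce
    then show "u \<rightarrow>\<^sup>*\<^bsub>with_proj (mk_symmetric (with_proj (host_tree V r par)))\<^esub> v"
      by (intro reachable_mk_symmetricI reachable_awalkI)
  qed
qed

lemma pcas_nth:
  "pcas u p v \<Longrightarrow> Suc i < length p \<Longrightarrow> fst (p ! Suc i) = snd (p ! i)"
  "pcas u p v \<Longrightarrow> p \<noteq> [] \<Longrightarrow> fst (p ! 0) = u \<and> snd (p ! (length p - 1)) = v"
proof (induction p arbitrary: u i)
  case (Cons e p)
  {
    case 1
    then show ?case using Cons.IH(1)[of "snd e" "i - 1"] by (cases i; cases p) auto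
  next
    case 2
    then show ?case using Cons.IH(2)[of "snd e"] by (cases p) auto
  }
qed auto

text \<open>On a cycle, both neighbours of a node of maximal level are its parent.\<close>
lemma host_acyclic:
  assumes T: "labelled_tree E w V r lab par dep lev"
  shows "\<not> (\<exists>p. pre_digraph.cycle (with_proj (host_tree V r par)) p \<and> 3 \<le> length p)"
proof
  interpret pair_graph "host_tree V r par" using host_pair_graph[OF T] .
  assume "\<exists>p. pre_digraph.cycle (with_proj (host_tree V r par)) p \<and> 3 \<le> length p"
  then obtain p u where p: "awalk u p u" "distinct (tl (pawalk_verts u p))" "3 \<le> length p"
    by (auto simp: cycle_def)
  define n where "n = length p"
  have cas: "pcas u p u" and arcs: "set p \<subseteq> tree_edges V r par" using p(1) by (auto simp: awalk_def)
  have "pawalk_verts v p' = v # map snd p'" if "pcas v p' v'" for v p' v'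
    using that by (induction p' arbitrary: v) auto
  from this[OF cas] have dist: "distinct (map snd p)" using p(2) by simp
  have next_arc: "fst (p ! (Suc i mod n)) = snd (p ! i)" if "i < n" for i
  proof (cases "Suc i < n")
    case True
    then show ?thesis using pcas_nth(1)[OF cas, of i] by (simp add: n_def)
  next
    case False
    then have "Suc i = n" using that by simp
    then have "Suc i mod n = 0" "i = length p - 1" "p \<noteq> []" by (auto simp: n_def)
    then show ?thesis using pcas_nth(2)[OF cas] by simp
  qed
  have n: "3 \<le> n" using p(3) by (simp add: n_def)
  define k where "k = arg_min_on (\<lambda>i. - int (lev (snd (p ! i)))) {..<n}"
  have k: "k < n" "\<And>i. i < n \<Longrightarrow> lev (snd (p ! i)) \<le> lev (snd (p ! k))"
    using arg_min_if_finite[of "{..<n}" "\<lambda>i. - int (lev (snd (p ! i)))"] n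
    unfolding k_def by (auto simp: not_less lessThan_empty_iff)
  define z where "z = snd (p ! k)"
  have parent: "b = par z" if "(z, b) \<in> tree_edges V r par" "lev b \<le> lev z" for b
    using that labelled_treeD(5)[OF T, of b] by (auto simp: tree_edges_def)
  \<comment> \<open>Arcs \<open>i\<close> and \<open>j\<close> end at the two neighbours of
    \<open>z\<close> on the cycle. Length at least 3 makes the indices differ, so equal endpoints
    contradict \<open>dist\<close>.\<close>
  define i where "i = (if k = 0 then n - 1 else k - 1)"
  define j where "j = (if Suc k = n then 0 else Suc k)"
  have ij: "i < n" "j < n" "Suc i mod n = k" "Suc k mod n = j" "i \<noteq> j"
    using k(1) n by (auto simp: i_def j_def)
  have "(z, snd (p ! j)) \<in> tree_edges V r par"
    using nth_mem[of j p] arcs ij next_arc[OF k(1)] by (metis n_def z_def in_mono prod.collapse)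
  then have b: "snd (p ! j) = par z" using parent k(2)[OF ij(2)] by (simp add: z_def)
  have "(snd (p ! i), z) \<in> tree_edges V r par"
    using nth_mem[of k p] arcs k(1) ij next_arc[OF ij(1)] by (metis n_def z_def in_mono prod.collapse)
  then have "(z, snd (p ! i)) \<in> tree_edges V r par" using tree_edges_sym by (meson symD)
  then have a: "snd (p ! i) = par z" using parent k(2)[OF ij(1)] by (simp add: z_def)
  have "map snd p ! i = map snd p ! j" using a b ij by (simp add: n_def)
  then show False using dist ij nth_eq_iff_index_eq[of "map snd p" i j] by (simp add: n_def)
qed

text \<open>\<open>lab\<close> maps tree walks to walks of \<open>G\<close> of equal cost, which
  gives domination. The escape for a single vertex covers the target distortion 0 that
  \<open>log 2 1 = 0\<close> produces; all distances are zero there.\<close>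

lemma spanning_clan_of_tree:
  assumes G: "weighted_graph G w"
    and CT: "clan_tree (parcs G) w (pverts G) w t V r lab par dep lev chi"
    and t: "t \<le> t' \<or> card (pverts G) = 1"
  shows "(host_tree V r par, pull_weight w lab, \<lambda>v. {z \<in> V. lab z = v}, chi)
    \<in> spanning_tree_clan_embeddings G w t'"
proof -
  note GD = weighted_graphD[OF G]
  have T: "labelled_tree (parcs G) w V r lab par dep lev" and lab: "lab ` V = pverts G"
    and chi: "\<And>v. v \<in> pverts G \<Longrightarrow> chi v \<in> V \<and> lab (chi v) = v"
    using CT by (auto simp: clan_tree_def)
  interpret G: pair_graph G by (rule GD(1))
  interpret H: pair_graph "host_tree V r par" by (rule host_pair_graph[OF T])
  have arc: "(lab y, lab z) \<in> parcs G" if "(y, z) \<in> tree_edges V r par" for y z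
    using tree_edges_lab[OF T GD(4) that] .
  let ?H = "host_tree V r par" and ?w = "pull_weight w lab" and ?f = "\<lambda>v. {z \<in> V. lab z = v}"
  have "weighted_graph ?H ?w"
    unfolding weighted_graph_def using host_pair_graph[OF T] host_connected[OF T GD(4,5)]
      GD(5,6)[OF arc] by (auto simp: pull_weight_def)
  moreover have "undirected_tree ?H"
    unfolding undirected_tree_def using host_pair_graph[OF T] host_connected[OF T GD(4,5)] host_acyclic[OF T] by blast
  moreover have "clan_embedding G w ?H ?w ?f chi"
    unfolding clan_embedding_def
  proof (intro conjI)
    show "one_to_many_embedding G ?H ?f"
      using chi by (auto simp: one_to_many_embedding_def disjoint_family_on_def)
    show "dominating G w ?H ?w ?f"
      unfolding dominating_def
    proof (intro ballI INF_greatest)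
      fix u v e assume uv: "u \<in> pverts G" "v \<in> pverts G" "e \<in> ?f u \<times> ?f v"
      have "sp_dist G w u v \<le> sp_dist ?H ?w u' v'" if "u' \<in> ?f u" "v' \<in> ?f v" for u' v'
      proof (rule H.le_sp_dist)
        fix c assume "walk_cost (parcs ?H) ?w u' v' c"
        then have "walk_cost (parcs G) w (lab u') (lab v') c"
          by (rule walk_map) (use arc in \<open>auto simp: pull_weight_def\<close>)
        then show "sp_dist G w u v \<le> ereal c" using that uv(1) by (intro G.sp_dist_le_walk) auto
      qed
      then show "sp_dist G w u v \<le> (case e of (u', v') \<Rightarrow> sp_dist ?H ?w u' v')" using uv(3) by auto
    qed
    show "\<forall>v\<in>pverts G. chi v \<in> ?f v" using chi by auto
  qed
  moreover have "spanning_embedding G w ?H ?w ?f"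
    unfolding spanning_embedding_def using lab arc by (auto simp: pull_weight_def)
  moreover have "multiplicative_distortion G w ?H ?w ?f chi t'"
    unfolding multiplicative_distortion_def
  proof (intro ballI)
    fix u v assume uv: "u \<in> pverts G" "v \<in> pverts G"
    then obtain c where c: "0 \<le> c" "walk_cost (parcs G) w u v c" "sp_dist G w u v = ereal c" using GD(7) by blast
    obtain u' c' where u': "u' \<in> V" "lab u' = u" "c' \<le> t * c"
      "walk_cost (tree_edges V r par) ?w u' (chi v) c'"
      using CT uv(1) c(2) unfolding clan_tree_def G.Restr_parcs by blast
    have "t * c \<le> t' * c"
    proof (cases "t \<le> t'")
      case False
      then have "u = v" using t uv by (auto simp: card_1_singleton_iff)
      then have "c \<le> 0" using G.sp_dist_le_walk[OF walk_refl uv(1), of w] c(3) by simp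
      then show ?thesis using c(1) by simp
    qed (use c(1) in \<open>simp add: mult_right_mono\<close>)
    then have "sp_dist ?H ?w u' (chi v) \<le> ereal (t' * c)"
      using H.sp_dist_le_walk[of ?w u' "chi v" c'] u' by (auto intro: order_trans)
    then have "(INF u'\<in>?f u. sp_dist ?H ?w u' (chi v)) \<le> ereal (t' * c)"
      using u' by (intro INF_lower2[of u']) auto
    then show "(INF u'\<in>?f u. sp_dist ?H ?w u' (chi v)) \<le> ereal t' * sp_dist G w u v"
      using c(3) by simp
  qed
  ultimately show ?thesis by (simp add: spanning_tree_clan_embeddings_def)
qed

text \<open>At the top level nothing has been halved, so the trivial path at an arbitrary root
  starts the recursion. Grouping tree nodes by label turns their total measure into the weighted
  number of copies.\<close>

lemma spanning_clan_for_measure: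
  fixes G :: "'a pair_pre_digraph"
  assumes G: "weighted_graph G w" and \<kappa>: "0 < \<kappa>"
    and mu: "\<And>v. v \<in> pverts G \<Longrightarrow> 1 \<le> mu v" and L: "log 2 (sum mu (pverts G)) < (1 + \<kappa>) ^ L"
    and t: "512 * real L \<le> t \<or> card (pverts G) = 1"
  shows "\<exists>e \<in> spanning_tree_clan_embeddings G w t.
    (\<Sum>v\<in>pverts G. mu v * copies v (e :: ('a, nat) embedding)) \<le> sum mu (pverts G) powr (1 + \<kappa>)"
proof -
  note GD = weighted_graphD[OF G]
  interpret G: pair_graph G by (rule GD(1))
  obtain x where x: "x \<in> pverts G" using GD(2) by auto
  obtain d where d: "root_dist (parcs G) (pverts G) w x d"
  proof (rule root_dist_exists[OF GD(3) x])
    show "\<exists>c. walk_cost (Restr (parcs G) (pverts G)) w x z c" if "z \<in> pverts G" for z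
      using GD(7)[OF x that] unfolding G.Restr_parcs by blast
  qed (use GD(6) in auto)
  have "rooted_clan (parcs G) w mu (512 * real L) 0 (pverts G) w x d (\<lambda>_. x) 0
      (sum mu (pverts G) powr (1 + \<kappa>))"
  proof (rule rooted_clan_exists[where mu = mu and L = L and \<kappa> = \<kappa>])
    show "w e \<le> 2 * w e" if "e \<in> Restr (parcs G) (pverts G)" for e using GD(6)[of e] that by auto
    show "w (y, z) = w (z, y)" if "(y, z) \<in> parcs G" for y z using GD(5)[OF that] .
    then show "w (y, z) = w (z, y)" if "(y, z) \<in> parcs G" for y z using that .
    show "tight_path (parcs G) (pverts G) w x d (\<lambda>_. x) 0" by (simp add: tight_path_def)
    show "1 \<le> mu v" if "v \<in> pverts G" for v using mu[OF that] .
  qed (rule GD(4) \<kappa> d L refl)+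
  then obtain V r lab par dep lev chi where
    CT: "clan_tree (parcs G) w (pverts G) w (512 * real L) V r lab par dep lev chi"
    and cost: "(\<Sum>z\<in>V. mu (lab z)) \<le> sum mu (pverts G) powr (1 + \<kappa>)"
    unfolding rooted_clan_def by - (elim exE conjE, rule that, assumption+)
  define e where "e = (host_tree V r par, pull_weight w lab, \<lambda>v. {z \<in> V. lab z = v}, chi)"
  have V: "finite V" "lab ` V = pverts G" using CT by (auto simp: clan_tree_def labelled_tree_def)
  have "(\<Sum>z\<in>V. mu (lab z)) = (\<Sum>v\<in>lab ` V. \<Sum>z\<in>{z \<in> V. lab z = v}. mu (lab z))"
    by (rule sum.image_gen[OF V(1)])
  also have "\<dots> = (\<Sum>v\<in>pverts G. mu v * copies v e)"
    unfolding V(2) by (intro sum.cong) (auto simp: copies_def e_def)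
  finally show ?thesis
    using spanning_clan_of_tree[OF G CT t] cost by (intro bexI[of _ e]) (auto simp: e_def)
qed

lemma copies_ge_1:
  assumes "weighted_graph G w" "e \<in> spanning_tree_clan_embeddings G w t" "v \<in> pverts G"
  shows "1 \<le> copies v e"
proof -
  obtain H wH f chi where e: "e = (H, wH, f, chi)" by (cases e)
  have "weighted_graph H wH" and f: "f v \<noteq> {}" "f v \<subseteq> pverts H"
    using assms(2,3) by (auto simp: e spanning_tree_clan_embeddings_def clan_embedding_def one_to_many_embedding_def)
  then have "finite (f v)" using weighted_graphD(3) finite_subset by blast
  then have "0 < card (f v)" using f(1) by (simp add: card_gt_0_iff)
  then show ?thesis by (simp add: e copies_def)
qed

section \<open>Distributions over clan embeddings\<close>

text \<open>Blackwell's approachability strategy replaces the minimax theorem: always answer the positive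
  part of the accumulated excess. The squared length of the excess then grows at most linearly.\<close>
lemma approachability:
  fixes f :: "'v \<Rightarrow> 'e \<Rightarrow> real"
  assumes V: "finite V" and bound: "\<And>e v. e \<in> S \<Longrightarrow> v \<in> V \<Longrightarrow> \<bar>f v e - c\<bar> \<le> K"
    and resp: "\<And>lam. (\<And>v. v \<in> V \<Longrightarrow> 0 \<le> lam v) \<Longrightarrow> \<exists>e\<in>S. (\<Sum>v\<in>V. lam v * (f v e - c)) \<le> 0"
    and \<eta>: "0 < \<eta>"
  shows "\<exists>D. set_pmf D \<subseteq> S \<and>
    (\<forall>v\<in>V. integrable (measure_pmf D) (f v) \<and> measure_pmf.expectation D (f v) \<le> c + \<eta>)"
proof -
  define s where "s es v = (\<Sum>i<length es. f v (es ! i) - c)" for es v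
  have step: "\<exists>es. length es = n \<and> set es \<subseteq> S \<and> (\<Sum>v\<in>V. (max 0 (s es v))\<^sup>2) \<le> real n * (real (card V) * K\<^sup>2)" for n
  proof (induction n)
    case (Suc n)
    then obtain es where es: "length es = n" "set es \<subseteq> S"
      "(\<Sum>v\<in>V. (max 0 (s es v))\<^sup>2) \<le> real n * (real (card V) * K\<^sup>2)" by auto
    obtain e where e: "e \<in> S" "(\<Sum>v\<in>V. max 0 (s es v) * (f v e - c)) \<le> 0"
      using resp[of "\<lambda>v. max 0 (s es v)"] by auto
    have s: "s (es @ [e]) v = s es v + (f v e - c)" for v by (simp add: s_def nth_append)
    \<comment> \<open>The cross term is at most zero by the choice of \<open>e\<close>, so a round
      adds at most \<open>card V * K\<^sup>2\<close> to the potential.\<close>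
    have "(\<Sum>v\<in>V. (max 0 (s (es @ [e]) v))\<^sup>2)
        \<le> (\<Sum>v\<in>V. (max 0 (s es v))\<^sup>2 + 2 * (max 0 (s es v) * (f v e - c)) + K\<^sup>2)"
    proof (rule sum_mono)
      fix v assume v: "v \<in> V"
      define y where "y = f v e - c"
      have "y\<^sup>2 \<le> K\<^sup>2" using bound[OF e(1) v] by (simp add: y_def abs_le_square_iff[symmetric])
      moreover have "(max 0 (s es v + y))\<^sup>2 \<le> (max 0 (s es v) + y)\<^sup>2"
        by (auto simp: abs_le_square_iff[symmetric] max_def)
      ultimately show "(max 0 (s (es @ [e]) v))\<^sup>2 \<le> (max 0 (s es v))\<^sup>2 + 2 * (max 0 (s es v) * (f v e - c)) + K\<^sup>2"
        by (simp add: s y_def[symmetric] power2_sum)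
    qed
    also have "\<dots> = (\<Sum>v\<in>V. (max 0 (s es v))\<^sup>2) + 2 * (\<Sum>v\<in>V. max 0 (s es v) * (f v e - c)) + real (card V) * K\<^sup>2"
      by (simp add: sum.distrib sum_distrib_left)
    also have "\<dots> \<le> real (Suc n) * (real (card V) * K\<^sup>2)" using es(3) e(2) by (simp add: algebra_simps)
    finally show ?case using es e(1) by (intro exI[of _ "es @ [e]"]) auto
  qed (auto simp: s_def)
  \<comment> \<open>Chosen so that the potential after \<open>n\<close> rounds, at most
    \<open>n * card V * K\<^sup>2\<close>, does not exceed \<open>(n * \<eta>)\<^sup>2\<close>; each
    average excess is then at most \<open>\<eta>\<close>.\<close>
  define n where "n = Suc (nat \<lceil>real (card V) * K\<^sup>2 / \<eta>\<^sup>2\<rceil>)"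
  have n: "0 < n" "real (card V) * K\<^sup>2 \<le> real n * \<eta>\<^sup>2"
  proof -
    have "real (card V) * K\<^sup>2 / \<eta>\<^sup>2 \<le> real n" unfolding n_def by linarith
    then show "real (card V) * K\<^sup>2 \<le> real n * \<eta>\<^sup>2" using \<eta> by (simp add: field_simps)
  qed (simp add: n_def)
  obtain es where es: "length es = n" "set es \<subseteq> S"
    "(\<Sum>v\<in>V. (max 0 (s es v))\<^sup>2) \<le> real n * (real (card V) * K\<^sup>2)" using step by blast
  have excess: "s es v \<le> real n * \<eta>" if v: "v \<in> V" for v
  proof -
    have "(max 0 (s es v))\<^sup>2 \<le> (\<Sum>v\<in>V. (max 0 (s es v))\<^sup>2)"
      by (rule member_le_sum[OF v]) (use V in auto)
    also have "\<dots> \<le> real n * (real n * \<eta>\<^sup>2)"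
      using es(3) n by (meson mult_left_mono of_nat_0_le_iff order_trans)
    finally have "(max 0 (s es v))\<^sup>2 \<le> (real n * \<eta>)\<^sup>2" by (simp add: power2_eq_square algebra_simps)
    then show ?thesis using \<eta> by (simp add: power2_le_imp_le[of "max 0 (s es v)" "real n * \<eta>"] abs_le_square_iff[symmetric])
  qed
  \<comment> \<open>Uniform over the rounds, not over the set of answers: repeated answers keep
    their weight.\<close>
  define D where "D = map_pmf ((!) es) (pmf_of_set {..<n})"
  have fin: "finite (set_pmf (pmf_of_set {..<n}))" and ne: "{..<n} \<noteq> {}" using n(1) by (auto simp: lessThan_empty_iff)
  have "set_pmf D \<subseteq> S"
    using es(1) ne by (auto simp: D_def set_pmf_of_set intro!: subsetD[OF es(2)] nth_mem)
  moreover have "integrable (measure_pmf D) (f v)" for v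
    using fin by (intro integrable_measure_pmf_finite) (simp add: D_def)
  moreover have "measure_pmf.expectation D (f v) \<le> c + \<eta>" if "v \<in> V" for v
  proof -
    have "measure_pmf.expectation D (f v) = (\<Sum>i<n. f v (es ! i)) / real n"
      using ne by (simp add: D_def integral_pmf_of_set)
    also have "(\<Sum>i<n. f v (es ! i)) = s es v + real n * c" by (simp add: s_def es(1) sum_subtractf)
    also have "\<dots> / real n \<le> (real n * \<eta> + real n * c) / real n"
      using excess[OF that] by (intro divide_right_mono) auto
    also have "\<dots> = c + \<eta>" using n(1) by (simp add: field_simps)
    finally show ?thesis .
  qed
  ultimately show ?thesis by blast
qed

text \<open>\<open>L = a * b\<close>: Bernoulli's inequality gives
  \<open>2 \<le> (1 + \<kappa>) ^ a\<close> for \<open>a\<close> about \<open>1 / \<kappa>\<close>,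
  and \<open>2 ^ b\<close> exceeds \<open>log 2 (2 * n)\<close> for \<open>b\<close> about
  \<open>loglog n\<close>. The argument is \<open>2 * n\<close> because the measures used have total
  at most that. From \<open>a \<le> 2 / \<kappa>\<close> and \<open>b \<le> 4 * loglog n\<close>
  comes \<open>4096 = 512 * 8\<close>.\<close>

lemma growth_exponent_exists:
  assumes \<kappa>: "0 < \<kappa>" "\<kappa> \<le> 1" and n: "1 \<le> (n :: nat)"
  shows "\<exists>L. log 2 (2 * real n) < (1 + \<kappa>) ^ L \<and> 512 * real L \<le> 4096 * (loglog n / \<kappa>)"
proof -
  define a where "a = nat \<lceil>1 / \<kappa>\<rceil>"
  define b where "b = nat \<lceil>loglog n\<rceil> + 2"
  have ll: "1 \<le> loglog n" by (simp add: loglog_def)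
  have a: "1 / \<kappa> \<le> real a" "real a \<le> 2 / \<kappa>"
  proof -
    have "1 \<le> 1 / \<kappa>" "0 < 1 / \<kappa>" using \<kappa> by auto
    then have "real a = of_int \<lceil>1 / \<kappa>\<rceil>" by (simp add: a_def)
    then show "1 / \<kappa> \<le> real a" "real a \<le> 2 / \<kappa>" using \<open>1 \<le> 1 / \<kappa>\<close> by linarith+
  qed
  have b: "loglog n + 2 \<le> real b" "real b \<le> 4 * loglog n"
    using ll unfolding b_def by linarith+
  have "1 \<le> \<kappa> * real a" using a(1) \<kappa> by (simp add: field_simps)
  then have "2 \<le> (1 + \<kappa>) ^ a" using Bernoulli_inequality[of \<kappa> a] \<kappa> by (simp add: mult.commute)
  then have "2 ^ b \<le> (1 + \<kappa>) ^ (a * b)" by (simp add: power_mult power_mono)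
  moreover have "log 2 (2 * real n) < 2 ^ b"
  proof -
    have "log 2 (real n) \<le> 2 powr loglog n"
    proof (cases "0 < log 2 (real n)")
      case True
      then have "log 2 (real n) = 2 powr (log 2 (log 2 (real n)))" by simp
      also have "\<dots> \<le> 2 powr loglog n" by (intro powr_mono) (auto simp: loglog_def)
      finally show ?thesis .
    qed (meson not_le order_trans less_imp_le powr_ge_zero le_less_linear)
    moreover have "2 \<le> 2 powr loglog n" using powr_mono[of 1 "loglog n" 2] ll by simp
    moreover have "log 2 (2 * real n) = 1 + log 2 (real n)" using n by (simp add: log_mult)
    ultimately have "log 2 (2 * real n) < 2 powr loglog n * 4" by simp
    also have "\<dots> = 2 powr (loglog n + 2)" by (simp add: powr_add)
    also have "\<dots> \<le> 2 powr real b" using b(1) by (intro powr_mono) auto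
    finally show ?thesis by (simp add: powr_realpow)
  qed
  ultimately have "log 2 (2 * real n) < (1 + \<kappa>) ^ (a * b)" by simp
  moreover have "real (a * b) \<le> (2 / \<kappa>) * (4 * loglog n)"
    unfolding of_nat_mult using a b \<kappa> by (intro mult_mono) auto
  then have "512 * real (a * b) \<le> 4096 * (loglog n / \<kappa>)" by simp
  ultimately show ?thesis by blast
qed

text \<open>Mixing the weights \<open>lam\<close> with the constant \<open>1\<close> bounds the number of copies of every vertex,
  whatever \<open>lam\<close> is.\<close>
lemma clan_distribution:
  fixes G :: "'a pair_pre_digraph" and c :: real
  assumes G: "weighted_graph G w" and \<kappa>: "0 < \<kappa>" "\<kappa> \<le> 1" and n: "n = card (pverts G)"
    and t: "4096 * (loglog n / \<kappa>) \<le> t \<or> n = 1" and \<eta>: "0 < \<eta>" and c0: "0 \<le> c"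
    and c: "\<And>M. real n \<le> M \<Longrightarrow> M \<le> 2 * real n \<Longrightarrow> M powr (1 + \<kappa>) - M + real n \<le> real n * c
      \<or> M powr (1 + \<kappa>) \<le> real n * c"
  shows "\<exists>D :: ('a, nat) embedding pmf. set_pmf D \<subseteq> spanning_tree_clan_embeddings G w t \<and>
    (\<forall>v\<in>pverts G. integrable (measure_pmf D) (copies v) \<and>
      measure_pmf.expectation D (copies v) \<le> c + \<eta>)"
proof -
  define B where "B = (2 * real n) powr (1 + \<kappa>)"
  define S where "S = {e \<in> spanning_tree_clan_embeddings G w t. \<forall>v\<in>pverts G. copies v (e :: ('a, nat) embedding) \<le> B}"
  have fin: "finite (pverts G)" and ne: "pverts G \<noteq> {}" using weighted_graphD(3,2)[OF G] .
  then have n1: "1 \<le> n" using n by (simp add: Suc_le_eq card_gt_0_iff)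
  obtain L where L: "log 2 (2 * real n) < (1 + \<kappa>) ^ L" "512 * real L \<le> 4096 * (loglog n / \<kappa>)"
    using growth_exponent_exists[OF \<kappa> n1] by blast
  have ge1: "1 \<le> copies v e" if "e \<in> spanning_tree_clan_embeddings G w t" "v \<in> pverts G"
    for v and e :: "('a, nat) embedding" using copies_ge_1[OF G that] .
  have resp: "\<exists>e\<in>S. (\<Sum>v\<in>pverts G. lam v * (copies v e - c)) \<le> 0"
    if lam: "\<And>v. v \<in> pverts G \<Longrightarrow> 0 \<le> lam v" for lam
  proof -
    define \<sigma> where "\<sigma> = sum lam (pverts G)"
    \<comment> \<open>If all weights vanish, \<open>lam v / 0 = 0\<close> leaves \<open>mu\<close>
      constantly 1 and \<open>M = n\<close>; otherwise \<open>M = 2 * n\<close>.\<close>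
    define mu where "mu v = 1 + real n * (lam v / \<sigma>)" for v
    have \<sigma>: "0 \<le> \<sigma>" unfolding \<sigma>_def using lam by (intro sum_nonneg)
    have mu: "1 \<le> mu v" if "v \<in> pverts G" for v using lam[OF that] \<sigma> by (simp add: mu_def)
    define M where "M = sum mu (pverts G)"
    have M_eq: "M = real n + real n * (\<sigma> / \<sigma>)"
      by (simp add: M_def mu_def sum.distrib n \<sigma>_def sum_distrib_left[symmetric] sum_divide_distrib[symmetric])
    have M: "real n \<le> M" "M \<le> 2 * real n" using \<sigma> by (cases "\<sigma> = 0"; simp add: M_eq)+
    have "log 2 M \<le> log 2 (2 * real n)" using M n1 by simp
    then have "log 2 (sum mu (pverts G)) < (1 + \<kappa>) ^ L" using L(1) by (simp add: M_def)
    moreover have "512 * real L \<le> t \<or> card (pverts G) = 1" using t L(2) n by auto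
    ultimately obtain e :: "('a, nat) embedding" where e: "e \<in> spanning_tree_clan_embeddings G w t"
      "(\<Sum>v\<in>pverts G. mu v * copies v e) \<le> M powr (1 + \<kappa>)"
      using spanning_clan_for_measure[where mu = mu, OF G \<kappa>(1) mu] unfolding M_def by blast
    have "copies v e \<le> B" if v: "v \<in> pverts G" for v
    proof -
      have "copies v e \<le> mu v * copies v e"
        using mult_right_mono[OF mu[OF v], of "copies v e"] ge1[OF e(1) v] by simp
      also have "\<dots> \<le> (\<Sum>v\<in>pverts G. mu v * copies v e)"
      proof (rule member_le_sum[OF v _ fin])
        show "0 \<le> mu u * copies u e" if "u \<in> pverts G - {v}" for u
          using mu[of u] ge1[OF e(1), of u] that by auto
      qed
      also have "\<dots> \<le> B" unfolding B_def using e(2) M \<kappa> n1 by (meson powr_mono2 order_trans add_nonneg_nonneg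
            less_imp_le zero_le_one of_nat_0_le_iff)
      finally show ?thesis .
    qed
    then have "e \<in> S" using e(1) by (simp add: S_def)
    moreover have "(\<Sum>v\<in>pverts G. lam v * (copies v e - c)) \<le> 0"
    proof (cases "\<sigma> = 0")
      case True
      then have "lam v = 0" if "v \<in> pverts G" for v
        using lam fin that by (simp add: \<sigma>_def sum_nonneg_eq_0_iff)
      then show ?thesis by simp
    next
      case False
      then have \<sigma>0: "0 < \<sigma>" using \<sigma> by simp
      define T where "T = (\<Sum>v\<in>pverts G. lam v * copies v e)"
      have split: "(\<Sum>v\<in>pverts G. mu v * copies v e) = (\<Sum>v\<in>pverts G. copies v e) + real n * (T / \<sigma>)"
        by (simp add: mu_def T_def distrib_right sum.distrib sum_distrib_left sum_divide_distrib mult.assoc)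
      \<comment> \<open>Every vertex has a copy, so the constant part of \<open>mu\<close> uses up
        at least \<open>n\<close> of the budget. As \<open>M = 2 * n\<close>, what remains is
        \<open>M powr (1 + \<kappa>) - M + n\<close>, the first alternative in the hypothesis on
        \<open>c\<close>; the second forgoes this saving.\<close>
      have low: "real n \<le> (\<Sum>v\<in>pverts G. copies v e)"
        using sum_mono[of "pverts G" "\<lambda>_. 1" "\<lambda>v. copies v e"] ge1[OF e(1)] by (simp add: n)
      have "M = 2 * real n" using False by (simp add: M_eq)
      then have "real n * (T / \<sigma>) \<le> real n * c" using split low e(2) c[OF M] by auto
      then have "T \<le> c * \<sigma>" using n1 \<sigma>0 by (simp add: field_simps)
      then show ?thesis by (simp add: T_def \<sigma>_def right_diff_distrib sum_subtractf sum_distrib_left sum_distrib_right mult.commute)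
    qed
    ultimately show ?thesis by blast
  qed
  have "\<bar>copies v e - c\<bar> \<le> B + c" if "e \<in> S" "v \<in> pverts G" for e v
    using that ge1[of e v] c0 by (auto simp: S_def abs_le_iff)
  from approachability[where f = copies, OF fin this resp \<eta>] show ?thesis unfolding S_def by blast
qed

(* The constants are chosen before the graph, epsilon and k. As 'a may be infinite,
   e.g. nat, they do not depend on the number of vertices. Host trees are finite, so nat
   suffices for their vertices. Integrability is stated because the Bochner integral
   of a non-integrable function is 0. *)
theorem theorem3:
  shows
    "(\<exists>C > 0. \<forall>(G :: 'a pair_pre_digraph) w (\<epsilon> :: real).
        weighted_graph G w \<and> 0 < \<epsilon> \<and> \<epsilon> \<le> 1 \<longrightarrow>
        (\<exists>D :: ('a, nat) embedding pmf.
           set_pmf D \<subseteq> spanning_tree_clan_embeddings G w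
             (C * (log 2 (card (pverts G)) * loglog (card (pverts G)) / \<epsilon>)) \<and>
           (\<forall>v \<in> pverts G.
              integrable (measure_pmf D) (copies v) \<and>
              measure_pmf.expectation D (copies v) \<le> 1 + \<epsilon>)))
     \<and>
     (\<exists>C\<^sub>1 > 0. \<exists>C\<^sub>2 > 0. \<forall>(G :: 'a pair_pre_digraph) w (k :: nat).
        weighted_graph G w \<and> 1 \<le> k \<longrightarrow>
        (\<exists>D :: ('a, nat) embedding pmf.
           set_pmf D \<subseteq> spanning_tree_clan_embeddings G w
             (C\<^sub>1 * (real k * loglog (card (pverts G)))) \<and>
           (\<forall>v \<in> pverts G.
              integrable (measure_pmf D) (copies v) \<and>
              measure_pmf.expectation D (copies v)
                \<le> C\<^sub>2 * real (card (pverts G)) powr (1 / real k))))"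
proof (intro conjI)
  have part1: "\<exists>D :: ('a, nat) embedding pmf.
      set_pmf D \<subseteq> spanning_tree_clan_embeddings G w (65536 * (log 2 (card (pverts G)) * loglog (card (pverts G)) / \<epsilon>)) \<and>
      (\<forall>v\<in>pverts G. integrable (measure_pmf D) (copies v) \<and> measure_pmf.expectation D (copies v) \<le> 1 + \<epsilon>)"
    if G: "weighted_graph G w" and \<epsilon>: "0 < \<epsilon>" "\<epsilon> \<le> 1" for G :: "'a pair_pre_digraph" and w and \<epsilon> :: real
  proof -
    define n where "n = card (pverts G)"
    have n1: "1 \<le> n" using weighted_graphD(2,3)[OF G] by (simp add: n_def Suc_le_eq card_gt_0_iff)
    define l where "l = log 2 (2 * real n)"
    have l: "l = 1 + log 2 (real n)" "1 \<le> l" using n1 by (auto simp: l_def log_mult)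
    \<comment> \<open>For \<open>M \<le> 2 * n\<close> this gives \<open>M powr \<kappa> \<le> 2
      powr (\<epsilon> / 8) \<le> 1 + \<epsilon> / 4\<close>, hence
      \<open>M powr (1 + \<kappa>) - M \<le> n * \<epsilon> / 2\<close>. The other
      \<open>\<epsilon> / 2\<close> is the slack of the repeated game.\<close>
    define \<kappa> where "\<kappa> = \<epsilon> / (8 * l)"
    have \<kappa>: "0 < \<kappa>" "\<kappa> \<le> 1" using \<epsilon> l(2) by (auto simp: \<kappa>_def)
    have "\<exists>D :: ('a, nat) embedding pmf.
        set_pmf D \<subseteq> spanning_tree_clan_embeddings G w (65536 * (log 2 n * loglog n / \<epsilon>)) \<and>
        (\<forall>v\<in>pverts G. integrable (measure_pmf D) (copies v) \<and>
          measure_pmf.expectation D (copies v) \<le> (1 + \<epsilon> / 2) + \<epsilon> / 2)"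
    proof (rule clan_distribution[OF G \<kappa> n_def])
      \<comment> \<open>For \<open>n\<close> at least 2, \<open>l\<close> is at most
        \<open>2 * log 2 n\<close>, so \<open>8 * l\<close> contributes the factor 16 in
        \<open>65536 = 4096 * 16\<close>. For \<open>n = 1\<close> the right side is zero, hence the
        alternative.\<close>
      show "4096 * (loglog n / \<kappa>) \<le> 65536 * (log 2 n * loglog n / \<epsilon>) \<or> n = 1"
      proof (cases "n = 1")
        case False
        then have "1 \<le> log 2 (real n)" using n1 by simp
        then have "8 * l \<le> 16 * log 2 (real n)" using l(1) by simp
        moreover have "0 \<le> loglog n" by (simp add: loglog_def)
        ultimately have "loglog n * (8 * l) \<le> loglog n * (16 * log 2 (real n))" by (rule mult_left_mono)
        then have "loglog n * (8 * l) / \<epsilon> \<le> loglog n * (16 * log 2 (real n)) / \<epsilon>"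
          using \<epsilon> by (intro divide_right_mono) auto
        moreover have "4096 * (loglog n / \<kappa>) = 4096 * (loglog n * (8 * l) / \<epsilon>)"
          "65536 * (log 2 n * loglog n / \<epsilon>) = 4096 * (loglog n * (16 * log 2 (real n)) / \<epsilon>)"
          by (simp_all add: \<kappa>_def)
        ultimately show ?thesis by linarith
      qed simp
      fix M assume M: "real n \<le> M" "M \<le> 2 * real n"
      have M0: "0 < M" using M n1 by simp
      have "M powr \<kappa> \<le> (2 * real n) powr \<kappa>" using M \<kappa> n1 by (intro powr_mono2) auto
      also have "\<dots> = (2 powr l) powr \<kappa>" using n1 by (simp add: l_def)
      also have "\<dots> = 2 powr (\<epsilon> / 8)" unfolding powr_powr \<kappa>_def using l(2) by simp
      also have "\<dots> = exp (ln 2 * \<epsilon> / 8)" by (simp add: powr_def)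
      also have "\<dots> \<le> exp (\<epsilon> / 8)" using \<epsilon> ln_2_less_1 by (simp add: mult_left_le_one_le)
      also have "\<dots> \<le> 1 + \<epsilon> / 8 + (\<epsilon> / 8)\<^sup>2" using \<epsilon> by (intro exp_bound) auto
      also have "\<dots> \<le> 1 + \<epsilon> / 4"
      proof -
        have "\<epsilon> * \<epsilon> \<le> \<epsilon> * 1" using \<epsilon> by (intro mult_left_mono) auto
        moreover have "(\<epsilon> / 8)\<^sup>2 = \<epsilon> * \<epsilon> / 64" by (simp add: power2_eq_square)
        ultimately show ?thesis using \<epsilon> by linarith
      qed
      finally have "M * (M powr \<kappa> - 1) \<le> 2 * real n * (\<epsilon> / 4)"
        using M M0 \<epsilon> by (intro order_trans[OF mult_left_mono mult_right_mono]) auto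
      moreover have "M powr (1 + \<kappa>) = M * M powr \<kappa>" using M0 by (simp add: powr_add)
      ultimately have "M powr (1 + \<kappa>) - M + real n \<le> real n * (1 + \<epsilon> / 2)" by (simp add: algebra_simps)
      then show "M powr (1 + \<kappa>) - M + real n \<le> real n * (1 + \<epsilon> / 2) \<or> M powr (1 + \<kappa>) \<le> real n * (1 + \<epsilon> / 2)" ..
    qed (use \<epsilon> in auto)
    then obtain D :: "('a, nat) embedding pmf" where
      D: "set_pmf D \<subseteq> spanning_tree_clan_embeddings G w (65536 * (log 2 n * loglog n / \<epsilon>))"
      "\<And>v. v \<in> pverts G \<Longrightarrow> integrable (measure_pmf D) (copies v)"
      "\<And>v. v \<in> pverts G \<Longrightarrow> measure_pmf.expectation D (copies v) \<le> (1 + \<epsilon> / 2) + \<epsilon> / 2" by blast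
    have "measure_pmf.expectation D (copies v) \<le> 1 + \<epsilon>" if "v \<in> pverts G" for v
      using D(3)[OF that] \<epsilon> by simp
    then show ?thesis using D(1,2) unfolding n_def by blast
  qed
  have part2: "\<exists>D :: ('a, nat) embedding pmf.
      set_pmf D \<subseteq> spanning_tree_clan_embeddings G w (4096 * (real k * loglog (card (pverts G)))) \<and>
      (\<forall>v\<in>pverts G. integrable (measure_pmf D) (copies v) \<and>
        measure_pmf.expectation D (copies v) \<le> 5 * real (card (pverts G)) powr (1 / real k))"
    if G: "weighted_graph G w" and k: "1 \<le> k" for G :: "'a pair_pre_digraph" and w and k :: nat
  proof -
    define n where "n = card (pverts G)"
    have n1: "1 \<le> n" using weighted_graphD(2,3)[OF G] by (simp add: n_def Suc_le_eq card_gt_0_iff)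
    define \<kappa> where "\<kappa> = 1 / real k"
    have \<kappa>: "0 < \<kappa>" "\<kappa> \<le> 1" using k by (auto simp: \<kappa>_def)
    have "\<exists>D :: ('a, nat) embedding pmf.
        set_pmf D \<subseteq> spanning_tree_clan_embeddings G w (4096 * (real k * loglog n)) \<and>
        (\<forall>v\<in>pverts G. integrable (measure_pmf D) (copies v) \<and>
          measure_pmf.expectation D (copies v) \<le> 4 * real n powr \<kappa> + real n powr \<kappa>)"
    \<comment> \<open>The factor 4 bounds \<open>2 powr (1 + \<kappa>)\<close>; the slack
      \<open>n powr \<kappa>\<close> makes it 5.\<close>
    proof (rule clan_distribution[OF G \<kappa> n_def])
      show "4096 * (loglog n / \<kappa>) \<le> 4096 * (real k * loglog n) \<or> n = 1" by (simp add: \<kappa>_def)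
      fix M assume M: "real n \<le> M" "M \<le> 2 * real n"
      have "M powr (1 + \<kappa>) \<le> (2 * real n) powr (1 + \<kappa>)" using M \<kappa> n1 by (intro powr_mono2) auto
      also have "\<dots> = 2 powr (1 + \<kappa>) * (real n * real n powr \<kappa>)" using n1 by (simp add: powr_mult powr_add)
      also have "\<dots> \<le> 2 powr 2 * (real n * real n powr \<kappa>)" using \<kappa> by (intro mult_right_mono powr_mono) auto
      finally show "M powr (1 + \<kappa>) - M + real n \<le> real n * (4 * real n powr \<kappa>) \<or>
        M powr (1 + \<kappa>) \<le> real n * (4 * real n powr \<kappa>)" by simp
    qed (use n1 in auto)
    then show ?thesis unfolding n_def \<kappa>_def by simp
  qed
  show "\<exists>C > 0. \<forall>(G :: 'a pair_pre_digraph) w (\<epsilon> :: real).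
      weighted_graph G w \<and> 0 < \<epsilon> \<and> \<epsilon> \<le> 1 \<longrightarrow>
      (\<exists>D :: ('a, nat) embedding pmf.
         set_pmf D \<subseteq> spanning_tree_clan_embeddings G w
           (C * (log 2 (card (pverts G)) * loglog (card (pverts G)) / \<epsilon>)) \<and>
         (\<forall>v \<in> pverts G. integrable (measure_pmf D) (copies v) \<and>
            measure_pmf.expectation D (copies v) \<le> 1 + \<epsilon>))"
    using part1 by (intro exI[of _ 65536]) simp
  show "\<exists>C\<^sub>1 > 0. \<exists>C\<^sub>2 > 0. \<forall>(G :: 'a pair_pre_digraph) w (k :: nat).
      weighted_graph G w \<and> 1 \<le> k \<longrightarrow>
      (\<exists>D :: ('a, nat) embedding pmf.
         set_pmf D \<subseteq> spanning_tree_clan_embeddings G w (C\<^sub>1 * (real k * loglog (card (pverts G)))) \<and>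
         (\<forall>v \<in> pverts G. integrable (measure_pmf D) (copies v) \<and>
            measure_pmf.expectation D (copies v) \<le> C\<^sub>2 * real (card (pverts G)) powr (1 / real k)))"
    using part2 by (intro exI[of _ 4096] exI[of _ 5] conjI) simp_all
qed

end
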